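(* Let $\varphi=\frac{1+\sqrt5}{2}$. Consider the game Peer Pressure with a deck of $n$ cards carrying distinct integers, dealt at random to Alice and Bob. (1) If the dealing is unbiased, then the probability that neither player has a winning strategy tends to $1$ as $n\to\infty$. (2) Let $r\ge 1$ be a fixed real number, and suppose the cards are dealt randomly so that Alice receives $r$ cards for every one card of Bob. (a) If $r<\varphi$, then the probability that neither player has a winning strategy tends to $1$ as $n\to\infty$. (b) If $r>\varphi$, then the probability that Alice has a winning strategy tends to $1$ as $n\to\infty$.
   Context: Peer Pressure. There are two players, Alice and Bob. A position consists of two disjoint finite sets of integers, Alice's hand and Bob's hand, not both empty (each integer is a card, and the integers are distinct). In each round (battle) the players simultaneously each choose one card from their own hand and play it. The player who played the higher card wins the round and takes the lower card into his or her hand; the higher card is permanently discarded from the game. Thus in each round the winner's number of cards is unchanged and the loser's decreases by one. The player who runs out of cards loses. Both players know the original deck, and hence know the contents of both hands at all times. Strategies. A pure strategy for a player assigns a card to play to each history of play (the initial hands and the cards played by both players in the previous rounds); the choice in a round cannot depend on the opponent's simultaneous choice. A mixed strategy is a probability distribution over pure strategies. A player has a winning strategy at a position if there is a strategy (possibly mixed) which she may announce in advance and with which she still always wins against every strategy of the opponent. If such a strategy exists, then a pure one also exists. Dealing. Only the relative order of the cards matters, so the deck may be taken to be $\{1,\dots,n\}$. Unbiased dealing means either that each player receives exactly $n/2$ cards ($n$ even), with all such deals equally likely, or that each card independently goes to either player with probability $1/2$. Dealing in which Alice receives $r$ cards for every card of Bob means the analogous thing with proportions $r:1$: either Alice receives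 a uniformly random subset of the deck of size $\frac{r}{r+1}n$ (rounded up or down to an integer) and Bob the rest, or each card independently goes to Alice with probability $\frac{r}{r+1}$ and to Bob with probability $\frac{1}{r+1}$. *)

theory Defs
  imports Complex_Main "HOL-Probability.Probability"
begin

text \<open>A position is the pair of hands (Alice's, Bob's); the player whose hand becomes empty
  loses.\<close>

type_synonym position = "int set \<times> int set"

definition valid_position :: "position \<Rightarrow> bool" where
  "valid_position P \<longleftrightarrow> finite (fst P) \<and> finite (snd P) \<and> fst P \<inter> snd P = {} \<and> \<not> (fst P = {} \<and> snd P = {})"

definition game_over :: "position \<Rightarrow> bool" where
  "game_over P \<longleftrightarrow> fst P = {} \<or> snd P = {}"

definition battle :: "position \<Rightarrow> int \<times> int \<Rightarrow> position" where
  "battle P ab = (case (P, ab) of ((A, B), (a, b)) \<Rightarrow>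
     if a > b then (insert b (A - {a}), B - {b})
     else (A - {a}, insert a (B - {b})))"

text \<open>The cards played so far, oldest round first; each pair is (Alice's card, Bob's card).\<close>

type_synonym history = "(int \<times> int) list"

definition hands_after :: "position \<Rightarrow> history \<Rightarrow> position" where
  "hands_after P h = foldl battle P h"

fun legal_history :: "position \<Rightarrow> history \<Rightarrow> bool" where
  "legal_history P [] \<longleftrightarrow> True"
| "legal_history P (ab # h) \<longleftrightarrow>
     fst ab \<in> fst P \<and> snd ab \<in> snd P \<and> legal_history (battle P ab) h"

text \<open>A pure strategy sees the initial hands and the previous rounds. Only its values at histories
  where the game is still going on matter; there the card must come from the player's own hand.\<close>

type_synonym pure_strategy = "position \<Rightarrow> history \<Rightarrow> int"

definition alice_strategies :: "pure_strategy set" where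
  "alice_strategies = {\<sigma>. \<forall>P h. valid_position P \<and> legal_history P h \<and> \<not> game_over (hands_after P h)
      \<longrightarrow> \<sigma> P h \<in> fst (hands_after P h)}"

definition bob_strategies :: "pure_strategy set" where
  "bob_strategies = {\<tau>. \<forall>P h. valid_position P \<and> legal_history P h \<and> \<not> game_over (hands_after P h)
      \<longrightarrow> \<tau> P h \<in> snd (hands_after P h)}"

text \<open>The history after at most k rounds; it stops growing once the game is over.\<close>

primrec play :: "pure_strategy \<Rightarrow> pure_strategy \<Rightarrow> position \<Rightarrow> nat \<Rightarrow> history" where
  "play \<sigma> \<tau> P 0 = []"
| "play \<sigma> \<tau> P (Suc k) =
     (let h = play \<sigma> \<tau> P k in
      if game_over (hands_after P h) then h else h @ [(\<sigma> P h, \<tau> P h)])"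

definition alice_wins :: "pure_strategy \<Rightarrow> pure_strategy \<Rightarrow> position \<Rightarrow> bool" where
  "alice_wins \<sigma> \<tau> P \<longleftrightarrow> (\<exists>k. snd (hands_after P (play \<sigma> \<tau> P k)) = {})"

definition bob_wins :: "pure_strategy \<Rightarrow> pure_strategy \<Rightarrow> position \<Rightarrow> bool" where
  "bob_wins \<sigma> \<tau> P \<longleftrightarrow> (\<exists>k. fst (hands_after P (play \<sigma> \<tau> P k)) = {})"

text \<open>Mixed strategies are discrete distributions over pure strategies. This is no restriction: from
  a fixed position only finitely many histories occur, so only finitely many pure strategies differ
  in play, and winning with probability 1 is the same as always winning.\<close>

definition alice_has_winning_strategy :: "position \<Rightarrow> bool" where
  "alice_has_winning_strategy P \<longleftrightarrow>
     (\<exists>p. set_pmf p \<subseteq> alice_strategies \<and>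
       (\<forall>q. set_pmf q \<subseteq> bob_strategies \<longrightarrow>
         measure_pmf.prob (pair_pmf p q) {(\<sigma>, \<tau>). alice_wins \<sigma> \<tau> P} = 1))"

definition bob_has_winning_strategy :: "position \<Rightarrow> bool" where
  "bob_has_winning_strategy P \<longleftrightarrow>
     (\<exists>q. set_pmf q \<subseteq> bob_strategies \<and>
       (\<forall>p. set_pmf p \<subseteq> alice_strategies \<longrightarrow>
         measure_pmf.prob (pair_pmf p q) {(\<sigma>, \<tau>). bob_wins \<sigma> \<tau> P} = 1))"

text \<open>Two ways of dealing a deck: both are distributions of Alice's hand, Bob receiving the rest.\<close>

definition deal_fixed_size :: "int set \<Rightarrow> nat \<Rightarrow> int set pmf" where
  "deal_fixed_size D k = pmf_of_set {A. A \<subseteq> D \<and> card A = k}"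

definition deal_independent :: "int set \<Rightarrow> real \<Rightarrow> int set pmf" where
  "deal_independent D p = map_pmf (\<lambda>f. {c \<in> D. f c}) (Pi_pmf D False (\<lambda>_. bernoulli_pmf p))"

text \<open>Here ws abbreviates winning strategy.\<close>

definition prob_alice_has_ws :: "int set \<Rightarrow> int set pmf \<Rightarrow> real" where
  "prob_alice_has_ws D deal = measure_pmf.prob deal {A. alice_has_winning_strategy (A, D - A)}"

definition prob_neither_has_ws :: "int set \<Rightarrow> int set pmf \<Rightarrow> real" where
  "prob_neither_has_ws D deal = measure_pmf.prob deal
     {A. \<not> alice_has_winning_strategy (A, D - A) \<and> \<not> bob_has_winning_strategy (A, D - A)}"

end

theory Submission
  imports Defs
begin

text \<open>
  An announced strategy lets the opponent foresee every card. Hence a player can force a win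
  exactly when the player wins the game of perfect information in which this player, the leader,
  lays a card openly and the opponent, the replier, then answers. The predicate \<open>reply_wins X Y\<close>
  says that the replier with hand \<open>Y\<close> beats the leader with hand \<open>X\<close>; the lemmas
  \<open>reply_wins_no_alice_strategy\<close>, \<open>reply_wins_no_bob_strategy\<close> and \<open>not_reply_wins_alice_strategy\<close>
  translate it into statements about strategies.

  The golden ratio arises as follows. Let the leader hold \<open>x\<close> cards, all below the \<open>y\<close> cards of the
  replier. The leader leads low cards until all \<open>y\<close> high cards are spent. Now the leader has \<open>x - y\<close>
  cards above all \<open>y\<close> cards of the replier, and leads these; the replier can only throw away
  low cards. This yields \<open>x - y\<close> cards all below \<open>2 * y - x\<close> cards, a position of the first kind. The
  ratio \<open>t = x / y\<close> has become \<open>(t - 1) / (2 - t)\<close>, a map with the repelling fixed point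
  \<open>t = (1 + sqrt 5) / 2\<close>. Linear potentials with coefficients in powers of this number turn the
  heuristic into three facts without any rounding: the leader wins every position with more than
  \<open>golden\<close> times as many cards (\<open>not_reply_wins_if_many\<close>); the replier wins with all cards above
  those of the leader as long as the leader has fewer than \<open>golden\<close> times as many
  (\<open>reply_wins_if_above\<close>); and the replier wins every position with more than \<open>golden\<close> times as many
  cards as the leader (\<open>reply_wins_if_many\<close>).

  The first fact and the law of large numbers give the case \<open>r > golden\<close>. For \<open>r < golden\<close> a typical
  deal is cut into a sum of games, in each of which the replier can answer separately
  (\<open>reply_wins_Un\<close>). Split the deck into a bounded number of consecutive blocks. In each of them the
  proportion of the leader's cards is close to the expected one, so the leader's cards in one block
  can be opposed by part of the replier's cards in the next block, in ratio below \<open>golden\<close>. The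
  leader's cards in the top block are opposed by the cards left over in all blocks, which are far
  more numerous if there are many blocks (\<open>reply_wins_by_blocks\<close>). Since \<open>r \<ge> 1\<close>, the same
  argument with the roles exchanged shows that Bob cannot force a win either.
\<close>

section \<open>Announced cards\<close>

text \<open>Equal cards are excluded in both alternatives, so that the predicate is symmetric under the exchange
  of the players; they do not occur in disjoint hands.\<close>

inductive reply_wins :: "int set \<Rightarrow> int set \<Rightarrow> bool" where
  reply: "(\<And>x. x \<in> X \<Longrightarrow> \<exists>y\<in>Y. (y < x \<and> reply_wins (insert y (X - {x})) (Y - {y})) \<or>
                          (x < y \<and> reply_wins (X - {x}) (insert x (Y - {y}))))
    \<Longrightarrow> reply_wins X Y"

lemma reply_wins_iff:
  "reply_wins X Y \<longleftrightarrow> (\<forall>x\<in>X. \<exists>y\<in>Y.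
     (y < x \<and> reply_wins (insert y (X - {x})) (Y - {y})) \<or>
     (x < y \<and> reply_wins (X - {x}) (insert x (Y - {y}))))"
  by (subst reply_wins.simps) blast

lemma reply_wins_empty_leader: "reply_wins {} Y"
  by (rule reply) simp

lemma reply_wins_empty_replier: "reply_wins X {} \<longleftrightarrow> X = {}"
  by (subst reply_wins.simps) auto

lemma legal_history_snoc:
  "legal_history P (h @ [ab]) \<longleftrightarrow> legal_history P h \<and>
     fst ab \<in> fst (hands_after P h) \<and> snd ab \<in> snd (hands_after P h)"
  by (induction h arbitrary: P) (auto simp: hands_after_def)

lemma hands_after_snoc: "hands_after P (h @ [ab]) = battle (hands_after P h) ab"
  by (simp add: hands_after_def)

lemma play_invariant:
  assumes "I P"
    and "\<And>h. legal_history P h \<Longrightarrow> I (hands_after P h) \<Longrightarrow> \<not> game_over (hands_after P h) \<Longrightarrow>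
           \<sigma> P h \<in> fst (hands_after P h) \<and> \<tau> P h \<in> snd (hands_after P h) \<and>
           I (battle (hands_after P h) (\<sigma> P h, \<tau> P h))"
  shows "legal_history P (play \<sigma> \<tau> P k) \<and> I (hands_after P (play \<sigma> \<tau> P k))"
proof (induction k)
  case 0
  then show ?case using assms(1) by (simp add: hands_after_def)
next
  case (Suc k)
  then show ?case using assms(2)[of "play \<sigma> \<tau> P k"]
    by (auto simp: Let_def legal_history_snoc hands_after_snoc)
qed

lemma valid_position_battle:
  assumes "valid_position P" "a \<in> fst P" "b \<in> snd P"
  shows "valid_position (battle P (a, b))"
  using assms by (auto simp: valid_position_def battle_def split: prod.splits)

lemma card_battle:
  assumes "valid_position P" "a \<in> fst P" "b \<in> snd P"
  shows "card (fst (battle P (a, b))) + card (snd (battle P (a, b))) < card (fst P) + card (snd P)"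
proof -
  obtain A B where P: "P = (A, B)" by (cases P)
  have f: "finite A" "finite B" "a \<in> A" "b \<in> B" "A \<inter> B = {}"
    using assms by (auto simp: P valid_position_def)
  then have "card A > 0" "card B > 0" "b \<notin> A" "a \<notin> B" by (auto simp: card_gt_0_iff)
  then show ?thesis using f by (auto simp: P battle_def card_insert_if)
qed

text \<open>Every round removes one card from the game, so a legal play ends.\<close>

lemma play_ends:
  assumes valid: "valid_position P"
    and legal: "\<And>h. legal_history P h \<Longrightarrow> \<not> game_over (hands_after P h) \<Longrightarrow>
           valid_position (hands_after P h) \<Longrightarrow>
           \<sigma> P h \<in> fst (hands_after P h) \<and> \<tau> P h \<in> snd (hands_after P h)"
  shows "\<exists>k. game_over (hands_after P (play \<sigma> \<tau> P k))"
proof (rule ccontr)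
  assume never: "\<nexists>k. game_over (hands_after P (play \<sigma> \<tau> P k))"
  define s where "s k = (let Q = hands_after P (play \<sigma> \<tau> P k) in card (fst Q) + card (snd Q))" for k
  have inv: "legal_history P (play \<sigma> \<tau> P k) \<and> valid_position (hands_after P (play \<sigma> \<tau> P k))" for k
    using valid legal valid_position_battle by (intro play_invariant) auto
  have "s (Suc k) < s k" for k
    using never inv[of k] legal[of "play \<sigma> \<tau> P k"]
    by (simp add: s_def Let_def hands_after_snoc card_battle)
  then have "s k + k \<le> s 0" for k
  proof (induction k)
    case (Suc k)
    then have "s (Suc k) < s k" "s k + k \<le> s 0" by auto
    then show ?case by simp
  qed simp
  from this[of "Suc (s 0)"] show False by simp
qed

lemma alice_strategiesD:
  assumes "\<sigma> \<in> alice_strategies" "valid_position P" "legal_history P h" "\<not> game_over (hands_after P h)"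
  shows "\<sigma> P h \<in> fst (hands_after P h)"
  using assms by (simp add: alice_strategies_def del: split_paired_All)

lemma bob_strategiesD:
  assumes "\<tau> \<in> bob_strategies" "valid_position P" "legal_history P h" "\<not> game_over (hands_after P h)"
  shows "\<tau> P h \<in> snd (hands_after P h)"
  using assms by (simp add: bob_strategies_def del: split_paired_All)

text \<open>A winning mixed strategy would make every pure strategy in its support win against everything. But
  against a single pure strategy of Alice, Bob can compute her next card from the history and reply
  to it.\<close>

lemma reply_wins_no_alice_strategy:
  assumes valid: "valid_position P" and win: "reply_wins (fst P) (snd P)"
  shows "\<not> alice_has_winning_strategy P"
proof
  assume "alice_has_winning_strategy P"
  then obtain p where p: "set_pmf p \<subseteq> alice_strategies"
    and sure: "\<And>q. set_pmf q \<subseteq> bob_strategies \<Longrightarrow>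
         measure_pmf.prob (pair_pmf p q) {(\<sigma>, \<tau>). alice_wins \<sigma> \<tau> P} = 1"
    unfolding alice_has_winning_strategy_def by blast
  obtain \<sigma> where \<sigma>: "\<sigma> \<in> set_pmf p" using set_pmf_not_empty[of p] by blast
  define good where "good Q a b \<longleftrightarrow> b \<in> snd Q \<and> (let R = battle Q (a, b) in reply_wins (fst R) (snd R))"
    for Q a b
  \<comment> \<open>The fallback keeps the strategy legal where no good reply exists.\<close>
  define \<tau> :: pure_strategy where "\<tau> = (\<lambda>Q h. let R = hands_after Q h; a = \<sigma> Q h in
      if \<exists>b. good R a b then SOME b. good R a b else SOME b. b \<in> snd R)"
  have mem: "\<tau> Q h \<in> snd (hands_after Q h)" if "\<not> game_over (hands_after Q h)" for Q h
  proof (cases "\<exists>b. good (hands_after Q h) (\<sigma> Q h) b")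
    case True
    then have "good (hands_after Q h) (\<sigma> Q h) (\<tau> Q h)" by (auto simp: \<tau>_def Let_def intro: someI)
    then show ?thesis by (simp add: good_def)
  next
    case False
    then show ?thesis using that by (auto simp: \<tau>_def Let_def game_over_def some_in_eq)
  qed
  then have \<tau>: "\<tau> \<in> bob_strategies" by (auto simp: bob_strategies_def)
  let ?I = "\<lambda>Q. valid_position Q \<and> reply_wins (fst Q) (snd Q)"
  have step: "\<sigma> P h \<in> fst (hands_after P h) \<and> \<tau> P h \<in> snd (hands_after P h) \<and>
           ?I (battle (hands_after P h) (\<sigma> P h, \<tau> P h))"
    if h: "legal_history P h" "?I (hands_after P h)" "\<not> game_over (hands_after P h)" for h
  proof -
    let ?Q = "hands_after P h"
    have a: "\<sigma> P h \<in> fst ?Q" using alice_strategiesD[OF subsetD[OF p \<sigma>] valid h(1,3)] .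
    then obtain y where "y \<in> snd ?Q" "(y < \<sigma> P h \<and> reply_wins (insert y (fst ?Q - {\<sigma> P h})) (snd ?Q - {y})) \<or>
       (\<sigma> P h < y \<and> reply_wins (fst ?Q - {\<sigma> P h}) (insert (\<sigma> P h) (snd ?Q - {y})))"
      using h(2) reply_wins_iff[of "fst ?Q" "snd ?Q"] by blast
    then have "good ?Q (\<sigma> P h) y" by (auto simp: good_def battle_def Let_def split: prod.splits)
    then have "good ?Q (\<sigma> P h) (\<tau> P h)" by (auto simp: \<tau>_def Let_def intro: someI)
    then show ?thesis using a h valid_position_battle by (auto simp: good_def Let_def)
  qed
  have inv: "?I (hands_after P (play \<sigma> \<tau> P k))" for k
    using play_invariant[of ?I P \<sigma> \<tau> k] valid win step by blast
  have "snd (hands_after P (play \<sigma> \<tau> P k)) \<noteq> {}" for k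
    using inv[of k] by (auto simp: valid_position_def reply_wins_empty_replier)
  then have "\<not> alice_wins \<sigma> \<tau> P" by (simp add: alice_wins_def)
  moreover have "\<forall>x\<in>set_pmf (pair_pmf p (return_pmf \<tau>)). x \<in> {(\<sigma>, \<tau>). alice_wins \<sigma> \<tau> P}"
    using sure[of "return_pmf \<tau>"] \<tau> by (simp add: measure_pmf.prob_eq_1 AE_measure_pmf_iff)
  ultimately show False using \<sigma> by auto
qed

lemma reply_wins_no_bob_strategy:
  assumes valid: "valid_position P" and win: "reply_wins (snd P) (fst P)"
  shows "\<not> bob_has_winning_strategy P"
proof
  assume "bob_has_winning_strategy P"
  then obtain q where q: "set_pmf q \<subseteq> bob_strategies"
    and sure: "\<And>p. set_pmf p \<subseteq> alice_strategies \<Longrightarrow>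
         measure_pmf.prob (pair_pmf p q) {(\<sigma>, \<tau>). bob_wins \<sigma> \<tau> P} = 1"
    unfolding bob_has_winning_strategy_def by blast
  obtain \<tau> where \<tau>: "\<tau> \<in> set_pmf q" using set_pmf_not_empty[of q] by blast
  define good where "good Q b a \<longleftrightarrow> a \<in> fst Q \<and> (let R = battle Q (a, b) in reply_wins (snd R) (fst R))"
    for Q a b
  define \<sigma> :: pure_strategy where "\<sigma> = (\<lambda>Q h. let R = hands_after Q h; b = \<tau> Q h in
      if \<exists>a. good R b a then SOME a. good R b a else SOME a. a \<in> fst R)"
  have mem: "\<sigma> Q h \<in> fst (hands_after Q h)" if "\<not> game_over (hands_after Q h)" for Q h
  proof (cases "\<exists>b. good (hands_after Q h) (\<tau> Q h) b")
    case True
    then have "good (hands_after Q h) (\<tau> Q h) (\<sigma> Q h)" by (auto simp: \<sigma>_def Let_def intro: someI)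
    then show ?thesis by (simp add: good_def)
  next
    case False
    then show ?thesis using that by (auto simp: \<sigma>_def Let_def game_over_def some_in_eq)
  qed
  then have \<sigma>: "\<sigma> \<in> alice_strategies" by (auto simp: alice_strategies_def)
  let ?I = "\<lambda>Q. valid_position Q \<and> reply_wins (snd Q) (fst Q)"
  have step: "\<sigma> P h \<in> fst (hands_after P h) \<and> \<tau> P h \<in> snd (hands_after P h) \<and>
           ?I (battle (hands_after P h) (\<sigma> P h, \<tau> P h))"
    if h: "legal_history P h" "?I (hands_after P h)" "\<not> game_over (hands_after P h)" for h
  proof -
    let ?Q = "hands_after P h"
    have b: "\<tau> P h \<in> snd ?Q" using bob_strategiesD[OF subsetD[OF q \<tau>] valid h(1,3)] .
    then obtain y where "y \<in> fst ?Q" "(y < \<tau> P h \<and> reply_wins (insert y (snd ?Q - {\<tau> P h})) (fst ?Q - {y})) \<or>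
       (\<tau> P h < y \<and> reply_wins (snd ?Q - {\<tau> P h}) (insert (\<tau> P h) (fst ?Q - {y})))"
      using h(2) reply_wins_iff[of "snd ?Q" "fst ?Q"] by blast
    then have "good ?Q (\<tau> P h) y" by (auto simp: good_def battle_def Let_def split: prod.splits)
    then have "good ?Q (\<tau> P h) (\<sigma> P h)" by (auto simp: \<sigma>_def Let_def intro: someI)
    then show ?thesis using b h valid_position_battle by (auto simp: good_def Let_def)
  qed
  have inv: "?I (hands_after P (play \<sigma> \<tau> P k))" for k
    using play_invariant[of ?I P \<sigma> \<tau> k] valid win step by blast
  have "fst (hands_after P (play \<sigma> \<tau> P k)) \<noteq> {}" for k
    using inv[of k] by (auto simp: valid_position_def reply_wins_empty_replier)
  then have "\<not> bob_wins \<sigma> \<tau> P" by (simp add: bob_wins_def)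
  moreover have "\<forall>x\<in>set_pmf (pair_pmf (return_pmf \<sigma>) q). x \<in> {(\<sigma>, \<tau>). bob_wins \<sigma> \<tau> P}"
    using sure[of "return_pmf \<sigma>"] \<sigma> by (simp add: measure_pmf.prob_eq_1 AE_measure_pmf_iff)
  ultimately show False using \<tau> by auto
qed

text \<open>Here Alice leads a card for which no reply helps Bob. Such a card exists at each stage, so she does
  not need to randomise.\<close>

lemma not_reply_wins_alice_strategy:
  assumes valid: "valid_position P" and win: "\<not> reply_wins (fst P) (snd P)"
  shows "alice_has_winning_strategy P"
proof -
  define good where "good Q a \<longleftrightarrow> a \<in> fst Q \<and>
      (\<forall>b\<in>snd Q. a \<noteq> b \<longrightarrow> (let R = battle Q (a, b) in \<not> reply_wins (fst R) (snd R)))"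
    for Q a
  define \<sigma> :: pure_strategy where "\<sigma> = (\<lambda>Q h. let R = hands_after Q h in
      if \<exists>a. good R a then SOME a. good R a else SOME a. a \<in> fst R)"
  have mem: "\<sigma> Q h \<in> fst (hands_after Q h)" if "\<not> game_over (hands_after Q h)" for Q h
  proof (cases "\<exists>a. good (hands_after Q h) a")
    case True
    then have "good (hands_after Q h) (\<sigma> Q h)" by (auto simp: \<sigma>_def Let_def intro: someI)
    then show ?thesis by (simp add: good_def)
  next
    case False
    then show ?thesis using that by (auto simp: \<sigma>_def Let_def game_over_def some_in_eq)
  qed
  then have \<sigma>: "\<sigma> \<in> alice_strategies" by (auto simp: alice_strategies_def)
  let ?I = "\<lambda>Q. valid_position Q \<and> \<not> reply_wins (fst Q) (snd Q)"
  have wins: "alice_wins \<sigma> \<tau> P" if \<tau>: "\<tau> \<in> bob_strategies" for \<tau>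
  proof -
    have step: "\<sigma> P h \<in> fst (hands_after P h) \<and> \<tau> P h \<in> snd (hands_after P h) \<and>
             ?I (battle (hands_after P h) (\<sigma> P h, \<tau> P h))"
      if h: "legal_history P h" "?I (hands_after P h)" "\<not> game_over (hands_after P h)" for h
    proof -
      let ?Q = "hands_after P h"
      have b: "\<tau> P h \<in> snd ?Q" using bob_strategiesD[OF \<tau> valid h(1,3)] .
      have "\<not> reply_wins (fst ?Q) (snd ?Q)" using h(2) by blast
      then obtain x where "x \<in> fst ?Q" "\<forall>y\<in>snd ?Q.
         \<not> (y < x \<and> reply_wins (insert y (fst ?Q - {x})) (snd ?Q - {y})) \<and>
         \<not> (x < y \<and> reply_wins (fst ?Q - {x}) (insert x (snd ?Q - {y})))"
        unfolding reply_wins_iff[of "fst ?Q" "snd ?Q"] by blast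
      then have "good ?Q x" by (auto simp: good_def battle_def Let_def split: prod.splits)
      then have good: "good ?Q (\<sigma> P h)" using someI[of "good ?Q" x] by (auto simp: \<sigma>_def Let_def)
      then have a: "\<sigma> P h \<in> fst ?Q" by (simp add: good_def)
      then have "\<sigma> P h \<noteq> \<tau> P h" using b h(2) by (auto simp: valid_position_def)
      then have "?I (battle ?Q (\<sigma> P h, \<tau> P h))"
        using good a b h(2) valid_position_battle by (simp add: good_def Let_def)
      then show ?thesis using a b by blast
    qed
    have inv: "?I (hands_after P (play \<sigma> \<tau> P k))" for k
      using play_invariant[of ?I P \<sigma> \<tau> k] valid win step by blast
    obtain k where "game_over (hands_after P (play \<sigma> \<tau> P k))"
      using play_ends[of P \<sigma> \<tau>] valid mem bob_strategiesD[OF \<tau> valid] by blast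
    moreover have "fst (hands_after P (play \<sigma> \<tau> P k)) \<noteq> {}"
      using inv[of k] by (auto simp: reply_wins_empty_leader)
    ultimately have "snd (hands_after P (play \<sigma> \<tau> P k)) = {}" by (simp add: game_over_def)
    then show ?thesis unfolding alice_wins_def by blast
  qed
  show ?thesis
    unfolding alice_has_winning_strategy_def
  proof (intro exI[of _ "return_pmf \<sigma>"] conjI allI impI)
    fix q assume "set_pmf q \<subseteq> bob_strategies"
    then show "measure_pmf.prob (pair_pmf (return_pmf \<sigma>) q) {(\<sigma>, \<tau>). alice_wins \<sigma> \<tau> P} = 1"
      using wins by (auto simp: measure_pmf.prob_eq_1 AE_measure_pmf_iff)
  qed (use \<sigma> in auto)
qed

section \<open>Sums of games\<close>

text \<open>The replier answers each card within the component that it comes from. As the captured card stays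
  in that component, the components never interact, and the replier survives in each of them. The
  nested rule induction follows the progress of both components.\<close>

lemma reply_wins_Un:
  assumes "reply_wins X Y" "reply_wins X' Y'" "(X \<union> Y) \<inter> (X' \<union> Y') = {}"
  shows "reply_wins (X \<union> X') (Y \<union> Y')"
  using assms
proof (induction arbitrary: X' Y' rule: reply_wins.induct)
  case (reply X Y)
  note outer = reply
  show ?case
    using outer(2,3)
  proof (induction rule: reply_wins.induct)
    case (reply X' Y')
    have right: "reply_wins X' Y'"
      unfolding reply_wins_iff[of X' Y'] using reply.IH by fast
    show ?case
    proof (rule reply_wins.reply)
      fix x assume "x \<in> X \<union> X'"
      then consider "x \<in> X" | "x \<in> X'" by blast
      then show "\<exists>y\<in>Y \<union> Y'.
          (y < x \<and> reply_wins (insert y (X \<union> X' - {x})) (Y \<union> Y' - {y})) \<or>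
          (x < y \<and> reply_wins (X \<union> X' - {x}) (insert x (Y \<union> Y' - {y})))"
      proof cases
        case x: 1
        from outer(1)[OF x] show ?thesis
        proof (elim bexE disjE conjE, goal_cases)
          case (1 y)
          have "reply_wins (insert y (X - {x}) \<union> X') (Y - {y} \<union> Y')"
            by (rule 1(4)[rule_format, OF right]) (use reply.prems x 1(1) in auto)
          also have "insert y (X - {x}) \<union> X' = insert y (X \<union> X' - {x})"
            using reply.prems x by auto
          also have "Y - {y} \<union> Y' = Y \<union> Y' - {y}"
            using reply.prems 1(1) by auto
          finally show ?case using 1(1,2) by blast
        next
          case (2 y)
          have "reply_wins (X - {x} \<union> X') (insert x (Y - {y}) \<union> Y')"
            by (rule 2(4)[rule_format, OF right]) (use reply.prems x 2(1) in auto)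
          also have "X - {x} \<union> X' = X \<union> X' - {x}"
            using reply.prems x by auto
          also have "insert x (Y - {y}) \<union> Y' = insert x (Y \<union> Y' - {y})"
            using reply.prems x 2(1) by auto
          finally show ?case using 2(1,2) by blast
        qed
      next
        case x: 2
        from reply.IH[OF x] show ?thesis
        proof (elim bexE disjE conjE, goal_cases)
          case (1 y)
          have "reply_wins (X \<union> insert y (X' - {x})) (Y \<union> (Y' - {y}))"
            by (rule 1(4)[rule_format]) (use reply.prems x 1(1) in auto)
          also have "X \<union> insert y (X' - {x}) = insert y (X \<union> X' - {x})"
            using reply.prems x by auto
          also have "Y \<union> (Y' - {y}) = Y \<union> Y' - {y}"
            using reply.prems 1(1) by auto
          finally show ?case using 1(1,2) by blast
        next
          case (2 y)
          have "reply_wins (X \<union> (X' - {x})) (Y \<union> insert x (Y' - {y}))"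
            by (rule 2(4)[rule_format]) (use reply.prems x 2(1) in auto)
          also have "X \<union> (X' - {x}) = X \<union> X' - {x}"
            using reply.prems x by auto
          also have "Y \<union> insert x (Y' - {y}) = insert x (Y \<union> Y' - {y})"
            using reply.prems x 2(1) by auto
          finally show ?case using 2(1,2) by blast
        qed
      qed
    qed
  qed
qed

section \<open>Positions decided by the numbers of cards\<close>

definition golden :: real where "golden = (1 + sqrt 5) / 2"

lemma golden_mult_golden: "golden * (golden * x) = golden * x + x"
  by (simp add: golden_def field_simps)

lemma golden_gt_1: "golden > 1"
  by (simp add: golden_def)

text \<open>The leader always leads the lowest card of \<open>S\<close>. Here \<open>J\<close> consists of the cards obtained by winning
  rounds, which are kept back; \<open>F\<close> of the replier's cards from the start of the current stage, and
  \<open>G\<close> of the cards that the replier has captured since then. With \<open>\<phi> = golden\<close>, the inequality reads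
  \<open>\<phi> * |G| + \<phi>^3 * |F| < |J| + \<phi>^2 * |S|\<close>. The weights are chosen such that a lead beaten by \<open>F\<close> and a
  lead on which \<open>G\<close> is thrown away change both sides by the same amount; throwing away a card of
  \<open>F\<close> makes the difference larger.\<close>

definition lead_invariant :: "int set \<Rightarrow> int set \<Rightarrow> int set \<Rightarrow> int set \<Rightarrow> bool" where
  "lead_invariant S J F G \<longleftrightarrow>
     finite S \<and> finite J \<and> finite F \<and> finite G \<and>
     S \<inter> J = {} \<and> F \<inter> G = {} \<and> (S \<union> J) \<inter> (F \<union> G) = {} \<and>
     (\<forall>g\<in>G. \<forall>s\<in>S. g < s) \<and>
     golden * card G + (2 * golden + 1) * card F < card J + (golden + 1) * card S"

text \<open>When \<open>S\<close> is exhausted, the inequality gives \<open>|J| > golden * |F \<union> G|\<close>, and the leader starts over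
  with \<open>J\<close> in the role of \<open>S\<close> and \<open>F \<union> G\<close> in the role of \<open>F\<close>. So the inequality can be restored in every
  position that the replier lets arise, which rules out a win of the replier by induction over it.\<close>

lemma lead_invariant_not_reply_wins:
  assumes "reply_wins X Y" "X = S \<union> J" "Y = F \<union> G"
  shows "\<not> lead_invariant S J F G"
  using assms
proof (induction arbitrary: S J F G rule: reply_wins.induct)
  case (reply X Y)
  have nonempty_case: False if inv: "lead_invariant S J F G" and "S \<noteq> {}"
      and X: "X = S \<union> J" and Y: "Y = F \<union> G" for S J F G
  proof -
    define a where "a = Min S"
    have fin: "finite S" "finite J" "finite F" "finite G"
      and disj: "S \<inter> J = {}" "F \<inter> G = {}" "(S \<union> J) \<inter> (F \<union> G) = {}"
      and G: "\<And>g s. g \<in> G \<Longrightarrow> s \<in> S \<Longrightarrow> g < s"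
      and ineq: "golden * card G + (2 * golden + 1) * card F < card J + (golden + 1) * card S"
      using inv by (auto simp: lead_invariant_def)
    have a: "a \<in> S" "\<And>s. s \<in> S \<Longrightarrow> a \<le> s" using fin \<open>S \<noteq> {}\<close> by (auto simp: a_def)
    have cS: "real (card (S - {a})) = real (card S) - 1"
      using a fin card_Suc_Diff1[of S a] by simp
    have "a \<in> X" using a X by auto
    then obtain y where y: "y \<in> Y" and
      r: "(y < a \<and> (\<forall>S' J' F' G'. insert y (X - {a}) = S' \<union> J' \<longrightarrow> Y - {y} = F' \<union> G' \<longrightarrow>
              \<not> lead_invariant S' J' F' G')) \<or>
          (a < y \<and> (\<forall>S' J' F' G'. X - {a} = S' \<union> J' \<longrightarrow> insert a (Y - {y}) = F' \<union> G' \<longrightarrow>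
              \<not> lead_invariant S' J' F' G'))"
      using reply.IH by meson
    have "a \<notin> J" "a \<notin> F" "a \<notin> G" "y \<notin> S" "y \<notin> J" using a y X Y disj by auto
    note mem = this
    have drop: "insert y (X - {a}) = (S - {a}) \<union> insert y J" "X - {a} = (S - {a}) \<union> J"
      using X mem by auto
    show False
    proof (cases "y \<in> F")
      case True
      then have "y \<notin> G" using disj by auto
      have cF: "real (card (F - {y})) = real (card F) - 1"
        using True fin card_Suc_Diff1[of F y] by simp
      have Y': "Y - {y} = (F - {y}) \<union> G" "insert a (Y - {y}) = (F - {y}) \<union> insert a G"
        using Y \<open>y \<notin> G\<close> by auto
      have "lead_invariant (S - {a}) (insert y J) (F - {y}) G"
        unfolding lead_invariant_def
      proof (intro conjI)
        show "golden * card G + (2 * golden + 1) * card (F - {y}) <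
              card (insert y J) + (golden + 1) * card (S - {a})"
          using ineq mem fin golden_gt_1 by (simp add: cF cS algebra_simps)
      qed (use fin disj G True in auto)
      moreover have "lead_invariant (S - {a}) J (F - {y}) (insert a G)"
        unfolding lead_invariant_def
      proof (intro conjI)
        show "golden * card (insert a G) + (2 * golden + 1) * card (F - {y}) <
              card J + (golden + 1) * card (S - {a})"
          using ineq mem fin by (simp add: cF cS algebra_simps)
        show "\<forall>g\<in>insert a G. \<forall>s\<in>S - {a}. g < s" using a G by (auto simp: order.strict_iff_order)
      qed (use fin disj G True mem a in auto)
      ultimately show False using r drop Y' by blast
    next
      case False
      then have "y \<in> G" using y Y by auto
      then have "y < a" using G a by auto
      have cG: "real (card (G - {y})) = real (card G) - 1"
        using \<open>y \<in> G\<close> fin card_Suc_Diff1[of G y] by simp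
      have Y': "Y - {y} = F \<union> (G - {y})"
        using Y False by auto
      have "lead_invariant (S - {a}) (insert y J) F (G - {y})"
        unfolding lead_invariant_def
      proof (intro conjI)
        show "golden * card (G - {y}) + (2 * golden + 1) * card F <
              card (insert y J) + (golden + 1) * card (S - {a})"
          using ineq mem fin golden_gt_1 by (simp add: cG cS algebra_simps)
      qed (use fin disj G False \<open>y \<in> G\<close> in auto)
      then show False using r drop Y' \<open>y < a\<close> by fastforce
    qed
  qed
  show ?case
  proof
    assume inv: "lead_invariant S J F G"
    show False
    proof (cases "S = {}")
      case False
      then show ?thesis using nonempty_case inv reply.prems by blast
    next
      case True
      have fin: "finite J" "finite F" "finite G" "F \<inter> G = {}" "J \<inter> (F \<union> G) = {}"
        and ineq: "golden * card G + (2 * golden + 1) * card F < card J"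
        using inv True by (auto simp: lead_invariant_def)
      have "golden * (card F + card G) \<le> golden * card G + (2 * golden + 1) * card F"
        using golden_gt_1 by (simp add: algebra_simps)
      then have big: "golden * card (F \<union> G) < card J"
        using ineq fin by (simp add: card_Un_disjoint)
      have "(2 * golden + 1) * card (F \<union> G) = (golden + 1) * (golden * card (F \<union> G))"
        by (simp add: golden_mult_golden algebra_simps)
      also have "\<dots> < (golden + 1) * card J"
        using big golden_gt_1 by simp
      finally have "lead_invariant J {} (F \<union> G) {}"
        using fin by (simp add: lead_invariant_def)
      moreover have "J \<noteq> {}" using big golden_gt_1 by (auto simp: mult_less_0_iff)
      ultimately show ?thesis
        using nonempty_case[of J "{}" "F \<union> G" "{}"] reply.prems True by simp
    qed
  qed
qed

lemma not_reply_wins_if_many: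
  assumes "finite X" "finite Y" "X \<inter> Y = {}" "golden * card Y < card X"
  shows "\<not> reply_wins X Y"
proof -
  have "(2 * golden + 1) * card Y = (golden + 1) * (golden * card Y)"
    by (simp add: golden_mult_golden algebra_simps)
  also have "\<dots> < (golden + 1) * card X"
    using assms golden_gt_1 by simp
  finally have "lead_invariant X {} Y {}"
    using assms by (simp add: lead_invariant_def)
  then show ?thesis using lead_invariant_not_reply_wins[of X Y X "{}" Y "{}"] by auto
qed

text \<open>The leader's hand is \<open>S \<union> L\<close> and the replier's is \<open>T \<union> H \<union> G\<close>. A card of \<open>S\<close> is answered from the
  reserve \<open>T\<close>, by a lower card if possible, which then joins \<open>L\<close>; a card of \<open>L\<close> is beaten by
  \<open>H\<close>, which lies above \<open>L\<close> and \<open>T\<close>. The captured cards form \<open>G\<close>. The condition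
  \<open>card S \<le> card T\<close> keeps the reserve from running out. As \<open>golden + 1\<close> is the square of \<open>golden\<close>, beating
  a card of \<open>L\<close> leaves the difference of the two sides unchanged.\<close>

definition reply_invariant :: "int set \<Rightarrow> int set \<Rightarrow> int set \<Rightarrow> int set \<Rightarrow> int set \<Rightarrow> bool" where
  "reply_invariant S L T H G \<longleftrightarrow>
     finite S \<and> finite L \<and> finite T \<and> finite H \<and> finite G \<and>
     S \<inter> L = {} \<and> T \<inter> H = {} \<and> T \<inter> G = {} \<and> H \<inter> G = {} \<and> (S \<union> L) \<inter> (T \<union> H \<union> G) = {} \<and>
     (\<forall>h\<in>H. \<forall>l\<in>L \<union> T. l < h) \<and> card S \<le> card T \<and>
     golden * (card S + card L) < card G + (golden + 1) * card H"

lemma lowest_cards: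
  fixes Y :: "int set"
  assumes "finite Y" "k \<le> card Y"
  obtains T where "T \<subseteq> Y" "card T = k" "\<And>t h. t \<in> T \<Longrightarrow> h \<in> Y - T \<Longrightarrow> t < h"
proof -
  have "\<exists>T\<subseteq>Y. card T = k \<and> (\<forall>t\<in>T. \<forall>h\<in>Y - T. t < h)"
    using assms(2)
  proof (induction k)
    case 0
    then show ?case by (intro exI[of _ "{}"]) auto
  next
    case (Suc k)
    then obtain T where T: "T \<subseteq> Y" "card T = k" "\<forall>t\<in>T. \<forall>h\<in>Y - T. t < h" by auto
    have "finite T" using T assms finite_subset by blast
    have ne: "Y - T \<noteq> {}" using T Suc.prems assms
      by (metis Diff_eq_empty_iff card_mono finite_subset not_less_eq_eq)
    define m where "m = Min (Y - T)"
    have m: "m \<in> Y - T" "\<And>h. h \<in> Y - T \<Longrightarrow> m \<le> h" using Min_in[of "Y - T"] ne assms by (auto simp: m_def)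
    show ?case
      by (rule exI[of _ "insert m T"]) (use T m \<open>finite T\<close> in \<open>force simp: order.strict_iff_order\<close>)
  qed
  then show ?thesis using that by blast
qed

text \<open>Once \<open>H\<close> is exhausted, the replier has more than \<open>golden\<close> times as many cards as the leader,
  however the cards are interleaved. Then the hands can be sorted afresh: the leader's whole hand
  becomes \<open>S\<close>, the same number of lowest cards of the replier becomes \<open>T\<close> and the rest becomes
  \<open>H\<close>. This regrouping removes no card, so the induction treats it together with the round that follows.\<close>

lemma reply_invariant_wins:
  assumes "reply_invariant S L T H G"
  shows "reply_wins (S \<union> L) (T \<union> H \<union> G)"
  using assms
proof (induction "card (S \<union> L) + card (T \<union> H \<union> G)" arbitrary: S L T H G rule: less_induct)
  case less
  have nonempty_case: "reply_wins (S' \<union> L') (T' \<union> H' \<union> G')"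
    if inv: "reply_invariant S' L' T' H' G'" and H: "H' \<noteq> {}"
      and size: "card (S' \<union> L') + card (T' \<union> H' \<union> G') = card (S \<union> L) + card (T \<union> H \<union> G)"
    for S' L' T' H' G'
  proof (rule reply_wins.reply)
    have fin: "finite S'" "finite L'" "finite T'" "finite H'" "finite G'"
      and disj: "S' \<inter> L' = {}" "T' \<inter> H' = {}" "T' \<inter> G' = {}" "H' \<inter> G' = {}"
        "(S' \<union> L') \<inter> (T' \<union> H' \<union> G') = {}"
      and above: "\<And>h l. h \<in> H' \<Longrightarrow> l \<in> L' \<union> T' \<Longrightarrow> l < h"
      and card: "card S' \<le> card T'"
      and ineq: "golden * (card S' + card L') < card G' + (golden + 1) * card H'"
      using inv by (auto simp: reply_invariant_def)
    have IH: "reply_wins (S1 \<union> L1) (T1 \<union> H1 \<union> G1)"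
      if "reply_invariant S1 L1 T1 H1 G1"
        "card S1 + card L1 + card T1 + card H1 + card G1
           < card S' + card L' + card T' + card H' + card G'" for S1 L1 T1 H1 G1
    proof (rule less.hyps[OF _ that(1)])
      have "card (S1 \<union> L1) + card (T1 \<union> H1 \<union> G1) = card S1 + card L1 + card T1 + card H1 + card G1"
        using that(1) by (simp add: reply_invariant_def card_Un_disjoint Int_Un_distrib2)
      moreover have "card (S' \<union> L') + card (T' \<union> H' \<union> G') = card S' + card L' + card T' + card H' + card G'"
        using inv by (simp add: reply_invariant_def card_Un_disjoint Int_Un_distrib2)
      ultimately show "card (S1 \<union> L1) + card (T1 \<union> H1 \<union> G1) < card (S \<union> L) + card (T \<union> H \<union> G)"
        using that(2) size by simp
    qed
    fix x assume "x \<in> S' \<union> L'"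
    then consider "x \<in> L'" | "x \<in> S'" by blast
    then show "\<exists>y\<in>T' \<union> H' \<union> G'.
          (y < x \<and> reply_wins (insert y (S' \<union> L' - {x})) (T' \<union> H' \<union> G' - {y})) \<or>
          (x < y \<and> reply_wins (S' \<union> L' - {x}) (insert x (T' \<union> H' \<union> G' - {y})))"
    proof cases
      case 1
      obtain h where h: "h \<in> H'" using H by blast
      have xh: "x < h" using above h 1 by auto
      have x: "x \<notin> S'" "x \<notin> T'" "x \<notin> H'" "x \<notin> G'" using 1 disj by auto
      have c: "card L' > 0" "card H' > 0" using 1 h fin by (auto simp: card_gt_0_iff)
      have "reply_invariant S' (L' - {x}) T' (H' - {h}) (insert x G')"
        unfolding reply_invariant_def
      proof (intro conjI)
        show "golden * (card S' + card (L' - {x})) < card (insert x G') + (golden + 1) * card (H' - {h})"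
          using ineq x fin 1 h c by (simp add: of_nat_diff algebra_simps)
      qed (use fin disj above card x 1 in auto)
      then have "reply_wins (S' \<union> (L' - {x})) (T' \<union> (H' - {h}) \<union> insert x G')"
        by (rule IH) (use x fin 1 h c in auto)
      moreover have "S' \<union> (L' - {x}) = S' \<union> L' - {x}"
        "T' \<union> (H' - {h}) \<union> insert x G' = insert x (T' \<union> H' \<union> G' - {h})"
        using x disj h by auto
      ultimately show ?thesis using h xh by (intro bexI[of _ h]) auto
    next
      case 2
      have x: "x \<notin> L'" "x \<notin> T'" "x \<notin> H'" "x \<notin> G'" using 2 disj by auto
      have c: "card S' > 0" "card T' > 0" using 2 card fin by (auto simp: card_gt_0_iff)
      then have "T' \<noteq> {}" by auto
      show ?thesis
      proof (cases "\<exists>t\<in>T'. t < x")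
        case True
        then obtain t where t: "t \<in> T'" "t < x" by blast
        have t': "t \<notin> S'" "t \<notin> L'" "t \<notin> H'" "t \<notin> G'" using t disj by auto
        have "reply_invariant (S' - {x}) (insert t L') (T' - {t}) H' G'"
          unfolding reply_invariant_def
        proof (intro conjI)
          show "golden * (card (S' - {x}) + card (insert t L')) < card G' + (golden + 1) * card H'"
            using ineq t' fin 2 c by (simp add: of_nat_diff algebra_simps)
        qed (use fin disj above card x t t' 2 in auto)
        then have "reply_wins ((S' - {x}) \<union> insert t L') ((T' - {t}) \<union> H' \<union> G')"
          by (rule IH) (use x t t' fin 2 c in auto)
        moreover have "(S' - {x}) \<union> insert t L' = insert t (S' \<union> L' - {x})"
          "(T' - {t}) \<union> H' \<union> G' = T' \<union> H' \<union> G' - {t}"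
          using x t t' by auto
        ultimately show ?thesis using t by (intro bexI[of _ t]) auto
      next
        case False
        obtain t where t: "t \<in> T'" using \<open>T' \<noteq> {}\<close> by blast
        then have xt: "x < t" using False x by (metis linorder_neqE)
        have t': "t \<notin> S'" "t \<notin> L'" "t \<notin> H'" "t \<notin> G'" using t disj by auto
        have "reply_invariant (S' - {x}) L' (T' - {t}) H' (insert x G')"
          unfolding reply_invariant_def
        proof (intro conjI)
          show "golden * (card (S' - {x}) + card L') < card (insert x G') + (golden + 1) * card H'"
            using ineq x fin 2 c golden_gt_1 by (simp add: of_nat_diff algebra_simps)
        qed (use fin disj above card x t t' 2 in auto)
        then have "reply_wins ((S' - {x}) \<union> L') ((T' - {t}) \<union> H' \<union> insert x G')"
          by (rule IH) (use x t t' fin 2 c in auto)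
        moreover have "(S' - {x}) \<union> L' = S' \<union> L' - {x}"
          "(T' - {t}) \<union> H' \<union> insert x G' = insert x (T' \<union> H' \<union> G' - {t})"
          using x t t' by auto
        ultimately show ?thesis using t xt by (intro bexI[of _ t]) auto
      qed
    qed
  qed
  show ?case
  proof (cases "H = {}")
    case False
    then show ?thesis using nonempty_case less.prems by blast
  next
    case True
    let ?X = "S \<union> L" and ?Y = "T \<union> G"
    have fin: "finite ?X" "finite ?Y" "?X \<inter> ?Y = {}"
      and ineq: "golden * card ?X < card G"
      using less.prems True by (auto simp: reply_invariant_def card_Un_disjoint)
    have "card G \<le> card ?Y" using fin by (intro card_mono) auto
    then have big: "golden * card ?X < card ?Y" using ineq by linarith
    have "real (card ?X) \<le> golden * card ?X" using golden_gt_1 by (simp add: mult_le_cancel_right1)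
    then have lt: "card ?X < card ?Y" using big by linarith
    obtain T1 where T1: "T1 \<subseteq> ?Y" "card T1 = card ?X" "\<And>t h. t \<in> T1 \<Longrightarrow> h \<in> ?Y - T1 \<Longrightarrow> t < h"
      using lowest_cards[of ?Y "card ?X"] fin lt by auto
    have "finite T1" using T1 fin finite_subset by blast
    then have cH: "real (card (?Y - T1)) = real (card ?Y) - real (card ?X)"
      using T1 lt by (simp add: card_Diff_subset of_nat_diff)
    have "golden * card ?X = (golden + 1) * ((golden - 1) * card ?X)"
      by (simp add: golden_mult_golden algebra_simps)
    also have "\<dots> < (golden + 1) * card (?Y - T1)"
      using big golden_gt_1 by (intro mult_strict_left_mono) (simp_all add: cH algebra_simps)
    finally have "reply_invariant ?X {} T1 (?Y - T1) {}"
      unfolding reply_invariant_def using fin T1 \<open>finite T1\<close> by auto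
    moreover have "?Y - T1 \<noteq> {}"
      using T1 lt by (metis Diff_eq_empty_iff less_irrefl_nat subset_antisym)
    moreover have "T1 \<union> (?Y - T1) = ?Y" using T1 by auto
    ultimately show ?thesis using nonempty_case[of ?X "{}" T1 "?Y - T1" "{}"] True by simp
  qed
qed

lemma reply_wins_if_above:
  assumes "finite X" "finite Y" "\<And>x y. x \<in> X \<Longrightarrow> y \<in> Y \<Longrightarrow> x < y" "card X < golden * card Y"
  shows "reply_wins X Y"
proof -
  have "golden * card X < golden * (golden * card Y)"
    using assms golden_gt_1 by simp
  also have "\<dots> = (golden + 1) * card Y"
    by (simp add: golden_mult_golden algebra_simps)
  finally have "reply_invariant {} X {} Y {}"
    unfolding reply_invariant_def using assms by force
  then show ?thesis using reply_invariant_wins by fastforce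
qed

lemma reply_wins_if_many:
  assumes "finite X" "finite Y" "X \<inter> Y = {}" "golden * card X < card Y"
  shows "reply_wins X Y"
proof -
  have "reply_invariant {} X {} {} Y"
    unfolding reply_invariant_def using assms by simp
  then show ?thesis using reply_invariant_wins by fastforce
qed

section \<open>Blocks of consecutive cards\<close>

lemma consecutive_blocks:
  fixes D :: "int set"
  assumes "finite D" "K * s \<le> card D"
  obtains I where "\<And>i. i < K \<Longrightarrow> I i \<subseteq> D" "\<And>i. i < K \<Longrightarrow> card (I i) = s"
    "\<And>i j x y. i < j \<Longrightarrow> j < K \<Longrightarrow> x \<in> I i \<Longrightarrow> y \<in> I j \<Longrightarrow> x < y"
proof -
  have "\<exists>I. (\<forall>i<K. I i \<subseteq> D \<and> card (I i) = s) \<and> (\<forall>j<K. \<forall>i<j. \<forall>x\<in>I i. \<forall>y\<in>I j. x < y)"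
    using assms
  proof (induction K arbitrary: D)
    case (Suc K)
    then have "K * s \<le> card D" by simp
    then obtain T where T: "T \<subseteq> D" "card T = K * s" "\<And>t h. t \<in> T \<Longrightarrow> h \<in> D - T \<Longrightarrow> t < h"
      using lowest_cards Suc.prems by metis
    have finT: "finite T" using T Suc.prems finite_subset by blast
    obtain I where I: "\<forall>i<K. I i \<subseteq> T \<and> card (I i) = s"
      "\<forall>j<K. \<forall>i<j. \<forall>x\<in>I i. \<forall>y\<in>I j. x < y"
      using Suc.IH[OF finT] T by auto
    have "s \<le> card (D - T)" using T finT Suc.prems by (simp add: card_Diff_subset)
    then obtain H where H: "H \<subseteq> D - T" "card H = s" using obtain_subset_with_card_n by metis
    have ID: "\<forall>i<K. I i \<subseteq> D \<and> card (I i) = s" using I(1) T(1) by blast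
    show ?case
    proof (intro exI[of _ "I(K := H)"] conjI allI impI ballI)
      fix j i x y assume ij: "j < Suc K" "i < j" and xy: "x \<in> (I(K := H)) i" "y \<in> (I(K := H)) j"
      show "x < y"
      proof (cases "j = K")
        case True
        then have "x \<in> T" "y \<in> D - T" using ij xy I(1) H by auto
        then show ?thesis using T(3) by blast
      next
        case False
        then have "j < K" using ij by simp
        moreover have "x \<in> I i" "y \<in> I j" using ij xy False by auto
        ultimately show ?thesis using ij(2) I(2) by blast
      qed
    next
      fix i assume "i < Suc K"
      then consider "i = K" | "i < K" by linarith
      then have "(I(K := H)) i \<subseteq> D \<and> card ((I(K := H)) i) = s"
      proof cases
        case 1
        moreover have "H \<subseteq> D" using H(1) by blast
        ultimately show ?thesis using H(2) by simp
      next
        case 2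
        then show ?thesis using ID by simp
      qed
      then show "(I(K := H)) i \<subseteq> D" "card ((I(K := H)) i) = s" by blast+
    qed
  qed simp
  then obtain I where I: "\<forall>i<K. I i \<subseteq> D \<and> card (I i) = s"
    "\<forall>j<K. \<forall>i<j. \<forall>x\<in>I i. \<forall>y\<in>I j. x < y" by blast
  show ?thesis
    by (rule that[of I]) (use I in \<open>simp_all\<close>)
qed

lemma reply_wins_UN:
  fixes X Y :: "nat \<Rightarrow> int set"
  assumes "\<And>i. i < k \<Longrightarrow> reply_wins (X i) (Y i)"
    and "\<And>i j. i < j \<Longrightarrow> j < k \<Longrightarrow> (X i \<union> Y i) \<inter> (X j \<union> Y j) = {}"
  shows "reply_wins (\<Union>i<k. X i) (\<Union>i<k. Y i)"
  using assms
proof (induction k)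
  case 0
  then show ?case by (auto intro: reply_wins.reply)
next
  case (Suc k)
  have "reply_wins ((\<Union>i<k. X i) \<union> X k) ((\<Union>i<k. Y i) \<union> Y k)"
  proof (rule reply_wins_Un)
    show "reply_wins (\<Union>i<k. X i) (\<Union>i<k. Y i)" using Suc.prems by (intro Suc.IH) auto
    show "reply_wins (X k) (Y k)" using Suc.prems by simp
    have "(X i \<union> Y i) \<inter> (X k \<union> Y k) = {}" if "i < k" for i using Suc.prems(2) that by simp
    then show "((\<Union>i<k. X i) \<union> (\<Union>i<k. Y i)) \<inter> (X k \<union> Y k) = {}" by fastforce
  qed
  then show ?case by (simp add: lessThan_Suc sup_commute[of "X k"] sup_commute[of "Y k"])
qed

lemma card_UN_in_blocks:
  fixes F J :: "nat \<Rightarrow> 'a set"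
  assumes "\<And>i. i < k \<Longrightarrow> finite (F i)" "\<And>i. i < k \<Longrightarrow> F i \<subseteq> J i"
    and "\<And>i j. i < j \<Longrightarrow> j < k \<Longrightarrow> J i \<inter> J j = {}"
  shows "card (\<Union>i<k. F i) = (\<Sum>i<k. card (F i))"
proof (rule card_UN_disjoint)
  have "F i \<inter> F j = {}" if "i < j" "j < k" for i j
    using assms(2)[OF less_trans[OF that]] assms(2)[OF that(2)] assms(3)[OF that] by blast
  then show "\<forall>i\<in>{..<k}. \<forall>j\<in>{..<k}. i \<noteq> j \<longrightarrow> F i \<inter> F j = {}"
    by (metis Int_commute lessThan_iff linorder_neqE_nat)
qed (use assms(1) in auto)

text \<open>Below the top block, the leader's cards in block \<open>i\<close> are opposed by \<open>y\<close> of the replier's cards in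
  block \<open>i + 1\<close>, all of which lie above them. At least \<open>e\<close> of the replier's cards are left over in
  each block but the lowest; together they oppose the leader's remaining cards, of which there are
  at most \<open>card D - k * s\<close>.\<close>

lemma reply_wins_by_blocks:
  fixes A D :: "int set" and I :: "nat \<Rightarrow> int set" and a e :: real and k s y :: nat
  assumes "finite D" "A \<subseteq> D"
    and I: "\<And>i. i < Suc k \<Longrightarrow> I i \<subseteq> D" "\<And>i. i < Suc k \<Longrightarrow> card (I i) = s"
    and less: "\<And>i j x y. i < j \<Longrightarrow> j < Suc k \<Longrightarrow> x \<in> I i \<Longrightarrow> y \<in> I j \<Longrightarrow> x < y"
    and few: "\<And>i. i < Suc k \<Longrightarrow> card (A \<inter> I i) \<le> a"
    and y: "a < golden * y" "a + y + e \<le> s"  "0 \<le> e"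
    and top: "golden * (real (card D) - k * s) < k * e"
  shows "reply_wins A (D - A)"
proof -
  have fin: "finite A" "\<And>i. i < Suc k \<Longrightarrow> finite (I i)"
    using finite_subset[OF assms(2,1)] finite_subset[OF I(1) assms(1)] by blast+
  have disj: "I i \<inter> I j = {}" if "i < j" "j < Suc k" for i j
    using less[OF that] by fastforce
  have cB: "a + card (I i - A) \<ge> s" if "i < Suc k" for i
  proof -
    have "card (I i) = card (A \<inter> I i) + card (I i - A)"
      using fin(2)[OF that] by (subst card_Un_disjoint[symmetric]) (auto intro: arg_cong[of _ _ card])
    then show ?thesis using few[OF that] I(2)[OF that] by linarith
  qed
  have "\<exists>Z. Z \<subseteq> I (Suc i) - A \<and> card Z = y" if "i < k" for i
  proof -
    have "real y \<le> card (I (Suc i) - A)" using cB[of "Suc i"] that y by simp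
    then have "y \<le> card (I (Suc i) - A)" by simp
    then obtain Z where "Z \<subseteq> I (Suc i) - A" "card Z = y" by (rule obtain_subset_with_card_n)
    then show ?thesis by blast
  qed
  then obtain Z where Z: "\<And>i. i < k \<Longrightarrow> Z i \<subseteq> I (Suc i) - A" "\<And>i. i < k \<Longrightarrow> card (Z i) = y"
    by metis
  define X where "X i = A \<inter> I i" for i
  let ?X = "\<Union>i<k. X i" and ?Z = "\<Union>i<k. Z i"
  have Zsub: "?Z \<subseteq> D - A" using Z I by fastforce
  have "reply_wins ?X ?Z"
  proof (rule reply_wins_UN)
    fix i assume i: "i < k"
    show "reply_wins (X i) (Z i)"
    proof (rule reply_wins_if_above)
      show "finite (X i)" "finite (Z i)"
        using fin Z(1)[OF i] i by (auto simp: X_def intro: finite_subset[OF _ fin(2)[of "Suc i"]])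
      show "x < z" if "x \<in> X i" "z \<in> Z i" for x z
        using less[of i "Suc i" x z] that Z(1)[OF i] i by (auto simp: X_def)
      show "card (X i) < golden * card (Z i)"
        using few[of i] y(1) Z(2)[OF i] i by (simp add: X_def)
    qed
  next
    fix i j assume ij: "i < j" "j < k"
    then have "i < k" by simp
    have "X i \<inter> Z j = {}" "Z i \<inter> X j = {}"
      using Z(1)[OF \<open>i < k\<close>] Z(1)[OF \<open>j < k\<close>] by (auto simp: X_def)
    moreover have "X i \<inter> X j = {}" using disj[of i j] ij by (auto simp: X_def)
    moreover have "Z i \<inter> Z j = {}" using disj[of "Suc i" "Suc j"] Z(1)[OF \<open>i < k\<close>] Z(1)[OF \<open>j < k\<close>] ij by auto
    ultimately show "(X i \<union> Z i) \<inter> (X j \<union> Z j) = {}" by blast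
  qed
  moreover have "reply_wins (A - ?X) (D - A - ?Z)"
  proof (rule reply_wins_if_many)
    show "finite (A - ?X)" "finite (D - A - ?Z)" "(A - ?X) \<inter> (D - A - ?Z) = {}"
      using fin assms by auto
    have sub: "(\<Union>i<k. I i) \<subseteq> D"
    proof (rule UN_least)
      show "I i \<subseteq> D" if "i \<in> {..<k}" for i using that I(1)[of i] by simp
    qed
    have "A - ?X \<subseteq> D - (\<Union>i<k. I i)" using \<open>A \<subseteq> D\<close> by (auto simp: X_def)
    then have "card (A - ?X) \<le> card (D - (\<Union>i<k. I i))" using assms by (intro card_mono) auto
    also have "\<dots> = card D - card (\<Union>i<k. I i)"
      using sub finite_subset[OF sub assms(1)] by (intro card_Diff_subset)
    also have cI: "card (\<Union>i<k. I i) = k * s"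
    proof -
      have "card (\<Union>i<k. I i) = (\<Sum>i<k. card (I i))"
        by (rule card_UN_in_blocks[of _ _ I]) (use fin disj in auto)
      then show ?thesis using I(2) by simp
    qed
    finally have cX: "card (A - ?X) \<le> card D - k * s" .
    have "card (\<Union>i<k. I i) \<le> card D" using card_mono[OF assms(1) sub] .
    then have "k * s \<le> card D" unfolding cI .
    then have cX': "real (card (A - ?X)) \<le> real (card D) - real k * s"
      using cX by (metis of_nat_diff of_nat_le_iff of_nat_mult)
    have "(\<Union>i<k. I (Suc i) - A - Z i) \<subseteq> D - A - ?Z"
    proof (intro UN_least subsetI)
      fix i x assume i: "i \<in> {..<k}" and x: "x \<in> I (Suc i) - A - Z i"
      have "x \<notin> Z j" if "j < k" for j
      proof (cases i j rule: linorder_cases)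
        case less
        then show ?thesis using disj[of "Suc i" "Suc j"] x Z(1)[of j] that by auto
      next
        case equal
        then show ?thesis using x by simp
      next
        case greater
        then show ?thesis using disj[of "Suc j" "Suc i"] x Z(1)[of j] that i by auto
      qed
      moreover have "x \<in> D" using x I(1)[of "Suc i"] i by auto
      ultimately show "x \<in> D - A - ?Z" using x by auto
    qed
    then have "card (\<Union>i<k. I (Suc i) - A - Z i) \<le> card (D - A - ?Z)"
      using assms by (intro card_mono) auto
    moreover have "card (\<Union>i<k. I (Suc i) - A - Z i) = (\<Sum>i<k. card (I (Suc i) - A - Z i))"
      by (rule card_UN_in_blocks[of _ _ "\<lambda>i. I (Suc i)"]) (use fin disj in auto)
    moreover have "k * e \<le> real (\<Sum>i<k. card (I (Suc i) - A - Z i))"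
    proof -
      have "(\<Sum>i<k. e) \<le> (\<Sum>i<k. real (card (I (Suc i) - A - Z i)))"
      proof (rule sum_mono)
        fix i assume i: "i \<in> {..<k}"
        then have "card (I (Suc i) - A - Z i) = card (I (Suc i) - A) - y"
          using Z[of i] fin(2)[of "Suc i"] by (subst card_Diff_subset) (auto intro: finite_subset)
        then show "e \<le> real (card (I (Suc i) - A - Z i))" using cB[of "Suc i"] i y by simp
      qed
      then show ?thesis by simp
    qed
    ultimately have "k * e \<le> card (D - A - ?Z)" by linarith
    moreover have "golden * card (A - ?X) \<le> golden * (real (card D) - k * s)"
      using cX' golden_gt_1 by simp
    ultimately show "golden * card (A - ?X) < card (D - A - ?Z)" using top by linarith
  qed
  ultimately have "reply_wins (?X \<union> (A - ?X)) (?Z \<union> (D - A - ?Z))"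
    by (rule reply_wins_Un) (use Zsub in \<open>auto simp: X_def\<close>)
  moreover have "?X \<union> (A - ?X) = A" "?Z \<union> (D - A - ?Z) = D - A"
    using Zsub by (auto simp: X_def)
  ultimately show ?thesis by simp
qed

section \<open>Deals with nearly uncorrelated cards\<close>

text \<open>The bound on pairs says that distinct cards are not positively correlated. This is all that a
  second-moment estimate needs, and it covers both ways of dealing.\<close>

definition spread_deal :: "'a set \<Rightarrow> real \<Rightarrow> 'a set pmf \<Rightarrow> bool" where
  "spread_deal D q M \<longleftrightarrow> finite D \<and> (\<forall>A\<in>set_pmf M. A \<subseteq> D) \<and>
     (\<forall>c\<in>D. measure_pmf.prob M {A. c \<in> A} = q) \<and>
     (\<forall>c\<in>D. \<forall>d\<in>D. c \<noteq> d \<longrightarrow> measure_pmf.prob M {A. c \<in> A \<and> d \<in> A} \<le> q\<^sup>2)"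

text \<open>Chebyshev's inequality: without positive correlations, the variance of the number of dealt cards in
  \<open>I\<close> is at most the sum of the variances of the indicators, each of which is at most \<open>1\<close>.\<close>

lemma spread_deal_deviation:
  fixes q \<epsilon> :: real
  assumes spread: "spread_deal D q M" and I: "I \<subseteq> D" and \<epsilon>: "\<epsilon> > 0"
  shows "measure_pmf.prob M {A. \<epsilon> \<le> \<bar>real (card (A \<inter> I)) - q * card I\<bar>} \<le> card I / \<epsilon>\<^sup>2"
proof -
  have finI: "finite I" using spread I finite_subset by (auto simp: spread_deal_def)
  have finM: "finite (set_pmf M)"
    using spread by (auto simp: spread_deal_def intro: finite_subset[of _ "Pow D"])
  note int = integrable_measure_pmf_finite[OF finM]
  define X where "X A = real (card (A \<inter> I))" for A
  have X: "X A = (\<Sum>c\<in>I. indicator {A. c \<in> A} A)" for A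
  proof -
    have "X A = (\<Sum>c\<in>A \<inter> I. 1)" by (simp add: X_def)
    also have "\<dots> = (\<Sum>c\<in>I. indicator {A. c \<in> A} A)"
      using finI by (intro sum.mono_neutral_cong_left) (auto simp: indicator_def)
    finally show ?thesis .
  qed
  have X2: "(X A)\<^sup>2 = (\<Sum>c\<in>I. \<Sum>d\<in>I. indicator {A. c \<in> A \<and> d \<in> A} A)" for A
    unfolding X power2_eq_square sum_product
    by (intro sum.cong refl) (auto simp: indicator_def)
  have EX: "measure_pmf.expectation M X = q * card I"
    unfolding X using spread I
    by (subst Bochner_Integration.integral_sum) (auto intro!: int simp: spread_deal_def subset_iff)
  have q01: "0 \<le> q \<and> q \<le> 1" if "c \<in> I" for c
    using that I spread measure_pmf.prob_le_1[of M "{A. c \<in> A}"] measure_nonneg[of M "{A. c \<in> A}"]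
    by (auto simp: spread_deal_def)
  have "measure_pmf.expectation M (\<lambda>A. (X A)\<^sup>2) =
      (\<Sum>c\<in>I. \<Sum>d\<in>I. measure_pmf.prob M {A. c \<in> A \<and> d \<in> A})"
    unfolding X2
    by (subst Bochner_Integration.integral_sum, (auto intro!: int)[1])
       (intro sum.cong refl, subst Bochner_Integration.integral_sum, auto intro!: int)
  also have "\<dots> \<le> (\<Sum>c\<in>I. \<Sum>d\<in>I. q\<^sup>2 + (if c = d then q else 0))"
  proof (intro sum_mono)
    fix c d assume "c \<in> I" "d \<in> I"
    then show "measure_pmf.prob M {A. c \<in> A \<and> d \<in> A} \<le> q\<^sup>2 + (if c = d then q else 0)"
      using spread I by (auto simp: spread_deal_def subset_iff)
  qed
  also have "\<dots> = (\<Sum>c\<in>I. q\<^sup>2 * card I + q)"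
    using finI by (intro sum.cong refl) (simp add: sum.distrib)
  also have "\<dots> \<le> (q * card I)\<^sup>2 + card I"
  proof -
    have "(\<Sum>c\<in>I. q\<^sup>2 * card I + q) \<le> (\<Sum>c\<in>I. q\<^sup>2 * card I + 1)"
      using q01 by (intro sum_mono) auto
    then show ?thesis by (simp add: power2_eq_square algebra_simps)
  qed
  finally have second: "measure_pmf.expectation M (\<lambda>A. (X A)\<^sup>2) \<le> (q * card I)\<^sup>2 + card I" .
  have "measure_pmf.prob M {A \<in> space M. \<bar>X A - measure_pmf.expectation M X\<bar> \<ge> \<epsilon>}
      \<le> measure_pmf.variance M X / \<epsilon>\<^sup>2"
    using \<epsilon> by (intro measure_pmf.Chebyshev_inequality int) auto
  also have "measure_pmf.variance M X = measure_pmf.expectation M (\<lambda>A. (X A)\<^sup>2) - (q * card I)\<^sup>2"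
    by (subst measure_pmf.variance_eq) (auto intro: int simp: EX)
  also have "\<dots> / \<epsilon>\<^sup>2 \<le> card I / \<epsilon>\<^sup>2"
    using second by (intro divide_right_mono) auto
  finally show ?thesis unfolding EX by (simp add: X_def)
qed

text \<open>If Alice's hand is dealt in this way, then so is Bob's.\<close>

lemma spread_deal_complement:
  assumes "spread_deal D q M"
  shows "spread_deal D (1 - q) (map_pmf (\<lambda>A. D - A) M)"
proof -
  have not_in: "measure_pmf.prob M {A. c \<notin> A} = 1 - measure_pmf.prob M {A. c \<in> A}" for c
    using measure_pmf.prob_compl[of "{A. c \<in> A}" M] by (simp add: Compl_eq_Diff_UNIV[symmetric] Collect_neg_eq)
  have neither: "measure_pmf.prob M {A. c \<notin> A \<and> d \<notin> A} \<le> (1 - q)\<^sup>2"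
    if cd: "c \<in> D" "d \<in> D" "c \<noteq> d" for c d
  proof -
    have "measure_pmf.prob M ({A. c \<in> A} \<union> {A. d \<in> A}) =
        q + q - measure_pmf.prob M ({A. c \<in> A} \<inter> {A. d \<in> A})"
      using cd assms by (subst measure_pmf.finite_measure_Union') (auto simp: spread_deal_def measure_pmf.finite_measure_Diff' Int_commute)
    moreover have "measure_pmf.prob M ({A. c \<in> A} \<inter> {A. d \<in> A}) \<le> q\<^sup>2"
      using cd assms by (simp add: spread_deal_def Collect_conj_eq)
    moreover have "{A. c \<notin> A \<and> d \<notin> A} = UNIV - ({A. c \<in> A} \<union> {A. d \<in> A})" by auto
    then have "measure_pmf.prob M {A. c \<notin> A \<and> d \<notin> A} = 1 - measure_pmf.prob M ({A. c \<in> A} \<union> {A. d \<in> A})"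
      using measure_pmf.prob_compl[of "{A. c \<in> A} \<union> {A. d \<in> A}" M] by simp
    ultimately show ?thesis by (simp add: power2_eq_square algebra_simps)
  qed
  show ?thesis
    using assms neither by (auto simp: spread_deal_def not_in)
qed

lemma card_subsets_containing:
  assumes "finite D" "C \<subseteq> D" "card C \<le> k"
  shows "card {A. A \<subseteq> D \<and> card A = k \<and> C \<subseteq> A} = (card D - card C) choose (k - card C)"
proof -
  have finC: "finite C" using assms finite_subset by blast
  have fin: "finite B" if "B \<subseteq> D - C" for B using that assms finite_subset by blast
  have "bij_betw (\<lambda>B. B \<union> C) {B. B \<subseteq> D - C \<and> card B = k - card C} {A. A \<subseteq> D \<and> card A = k \<and> C \<subseteq> A}"
  proof (rule bij_betwI[where g = "\<lambda>A. A - C"])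
    show "(\<lambda>B. B \<union> C) \<in> {B. B \<subseteq> D - C \<and> card B = k - card C} \<rightarrow> {A. A \<subseteq> D \<and> card A = k \<and> C \<subseteq> A}"
    proof
      fix B assume B: "B \<in> {B. B \<subseteq> D - C \<and> card B = k - card C}"
      then have "B \<inter> C = {}" by blast
      then show "B \<union> C \<in> {A. A \<subseteq> D \<and> card A = k \<and> C \<subseteq> A}"
        using B assms finC fin[of B] by (auto simp: card_Un_disjoint)
    qed
  qed (use finC in \<open>auto simp: card_Diff_subset\<close>)
  then have "card {A. A \<subseteq> D \<and> card A = k \<and> C \<subseteq> A} = card {B. B \<subseteq> D - C \<and> card B = k - card C}"
    by (rule bij_betw_same_card[symmetric])
  also have "\<dots> = (card D - card C) choose (k - card C)"
    using assms finC by (simp add: n_subsets card_Diff_subset)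
  finally show ?thesis .
qed

text \<open>The probability that two given cards are both dealt is \<open>(k / n) * ((k - 1) / (n - 1))\<close>, and the
  second factor is at most the first because \<open>k \<le> n\<close>.\<close>

lemma spread_deal_fixed_size:
  assumes D: "finite D" and k: "k \<le> card D"
  shows "spread_deal D (k / card D) (deal_fixed_size D k)"
proof -
  let ?n = "card D" and ?S = "{A. A \<subseteq> D \<and> card A = k}"
  obtain T where "T \<subseteq> D" "card T = k" using k obtain_subset_with_card_n by blast
  then have S: "finite ?S" "?S \<noteq> {}" "card ?S = ?n choose k"
    using D by (auto simp: n_subsets)
  have pos: "?n choose k > 0" using k by simp
  have prob: "measure_pmf.prob (deal_fixed_size D k) {A. C \<subseteq> A} =
      real (card {A. A \<subseteq> D \<and> card A = k \<and> C \<subseteq> A}) / real (?n choose k)" for C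
    using S by (simp add: deal_fixed_size_def measure_pmf_of_set Int_def conj_assoc)
  have few: "{A. A \<subseteq> D \<and> card A = k \<and> C \<subseteq> A} = {}" if "k < card C" for C
  proof -
    have "card C \<le> card A" if "A \<subseteq> D" "C \<subseteq> A" for A
      using card_mono[OF finite_subset[OF that(1) D] that(2)] .
    then show ?thesis using that by (auto simp: not_le[symmetric])
  qed
  have "measure_pmf.prob (deal_fixed_size D k) {A. c \<in> A} = k / ?n" if c: "c \<in> D" for c
  proof (cases "k = 0")
    case True
    then have "k < card {c}" by simp
    then have "measure_pmf.prob (deal_fixed_size D k) {A. {c} \<subseteq> A} = 0"
      unfolding prob by (subst few) auto
    then show ?thesis using True by simp
  next
    case False
    have n: "?n > 0" using c D by (auto simp: card_gt_0_iff)
    have "real (card {A. A \<subseteq> D \<and> card A = k \<and> {c} \<subseteq> A}) = real ((?n - 1) choose (k - 1))"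
      using card_subsets_containing[of D "{c}" k] c D False by simp
    then have eq: "measure_pmf.prob (deal_fixed_size D k) {A. c \<in> A} =
        real ((?n - 1) choose (k - 1)) / real (?n choose k)"
      using prob[of "{c}"] by simp
    have "real k * real (?n choose k) = real ?n * real ((?n - 1) choose (k - 1))"
      using arg_cong[OF times_binomial_minus1_eq[of k ?n], of real] False by simp
    then have "real ((?n - 1) choose (k - 1)) / real (?n choose k) = real k / real ?n"
      using pos n by (simp add: frac_eq_eq mult_ac)
    with eq show ?thesis by simp
  qed
  moreover have "measure_pmf.prob (deal_fixed_size D k) {A. c \<in> A \<and> d \<in> A} \<le> (k / ?n)\<^sup>2"
    if cd: "c \<in> D" "d \<in> D" "c \<noteq> d" for c d
  proof (cases "k < 2")
    case True
    then have "k < card {c, d}" using cd by simp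
    then have "measure_pmf.prob (deal_fixed_size D k) {A. {c, d} \<subseteq> A} = 0"
      unfolding prob by (subst few) auto
    then show ?thesis by simp
  next
    case False
    have "card {c, d} \<le> ?n" using cd D by (intro card_mono) auto
    then have n: "?n \<ge> 2" using cd by simp
    have "real (card {A. A \<subseteq> D \<and> card A = k \<and> {c, d} \<subseteq> A}) = real ((?n - 2) choose (k - 2))"
      using card_subsets_containing[of D "{c, d}" k] cd D False by (simp add: numeral_2_eq_2)
    then have eq: "measure_pmf.prob (deal_fixed_size D k) {A. c \<in> A \<and> d \<in> A} =
        real ((?n - 2) choose (k - 2)) / real (?n choose k)"
      using prob[of "{c, d}"] by simp
    have first: "real k * real (?n choose k) = real ?n * real ((?n - 1) choose (k - 1))"
      using arg_cong[OF times_binomial_minus1_eq[of k ?n], of real] False by simp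
    have second: "real (k - 1) * real ((?n - 1) choose (k - 1)) = real (?n - 1) * real ((?n - 2) choose (k - 2))"
      using arg_cong[OF times_binomial_minus1_eq[of "k - 1" "?n - 1"], of real] False
      by (simp add: numeral_2_eq_2)
    have "real ((?n - 2) choose (k - 2)) * (real ?n * real (?n - 1)) =
        real ?n * (real (k - 1) * real ((?n - 1) choose (k - 1)))"
      unfolding second by simp
    also have "\<dots> = real k * real (k - 1) * real (?n choose k)"
      using first by simp
    finally have "real ((?n - 2) choose (k - 2)) / real (?n choose k) =
        (real k / real ?n) * (real (k - 1) / real (?n - 1))"
      using pos n by (simp add: frac_eq_eq mult_ac)
    with eq have "measure_pmf.prob (deal_fixed_size D k) {A. c \<in> A \<and> d \<in> A} =
        (real k / real ?n) * (real (k - 1) / real (?n - 1))" by simp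
    moreover have "real (k - 1) / real (?n - 1) \<le> real k / real ?n"
      using k n False by (simp add: field_simps of_nat_diff)
    ultimately show ?thesis by (simp only: power2_eq_square) (intro mult_left_mono, auto)
  qed
  ultimately show ?thesis
    using D S by (auto simp: spread_deal_def deal_fixed_size_def)
qed

lemma spread_deal_independent:
  assumes D: "finite D" and p: "0 \<le> p" "p \<le> 1"
  shows "spread_deal D p (deal_independent D p)"
proof -
  let ?M = "Pi_pmf D False (\<lambda>_. bernoulli_pmf p)"
  have prob: "measure_pmf.prob (deal_independent D p) {A. C \<subseteq> A} = p ^ card C" if C: "C \<subseteq> D" for C
  proof -
    have "measure_pmf.prob (deal_independent D p) {A. C \<subseteq> A} =
        measure_pmf.prob ?M (Pi D (\<lambda>c. if c \<in> C then {True} else UNIV))"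
      using C by (simp add: deal_independent_def vimage_def Pi_def subset_iff)
    also have "\<dots> = (\<Prod>c\<in>D. if c \<in> C then p else 1)"
      using D p by (subst measure_Pi_pmf_Pi) (auto intro!: prod.cong simp: measure_pmf_single)
    also have "\<dots> = p ^ card C"
      using D C by (simp add: prod.If_cases Int_absorb1 Int_absorb2)
    finally show ?thesis .
  qed
  show ?thesis
    using prob[of "{_}"] prob[of "{_, _}"] D
    by (auto simp: spread_deal_def deal_independent_def power2_eq_square)
qed

section \<open>Typical deals\<close>

lemma tendsto_1_if_failure_small:
  fixes f :: "nat \<Rightarrow> real" and s :: "nat \<Rightarrow> nat"
  assumes "filterlim s at_top sequentially"
    and "\<forall>\<^sub>F m in sequentially. 1 - C / real (s m) \<le> f m"
    and "\<And>m. f m \<le> 1"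
  shows "f \<longlonglongrightarrow> 1"
proof (rule tendsto_sandwich[OF assms(2)])
  have "filterlim (\<lambda>m. real (s m)) at_top sequentially"
    by (rule filterlim_compose[OF filterlim_real_sequentially assms(1)])
  then have "(\<lambda>m. C / real (s m)) \<longlonglongrightarrow> 0"
    by (intro tendsto_divide_0[OF tendsto_const] filterlim_at_top_imp_at_infinity)
  then have "(\<lambda>m. 1 - C / real (s m)) \<longlonglongrightarrow> 1 - 0"
    by (intro tendsto_diff tendsto_const)
  then show "(\<lambda>m. 1 - C / real (s m)) \<longlonglongrightarrow> 1" by simp
qed (use assms(3) in auto)

lemma prob_good_ge:
  assumes "\<forall>A\<in>set_pmf M. A \<notin> bad \<longrightarrow> A \<in> good" "measure_pmf.prob M bad \<le> b"
  shows "1 - b \<le> measure_pmf.prob M good"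
proof -
  have "1 - measure_pmf.prob M good = measure_pmf.prob M (UNIV - good)"
    using measure_pmf.prob_compl[of good M] by simp
  also have "\<dots> \<le> measure_pmf.prob M bad"
    using assms(1) by (intro measure_pmf.finite_measure_mono_AE) (auto simp: AE_measure_pmf_iff)
  finally show ?thesis using assms(2) by linarith
qed

text \<open>The condition \<open>golden * p < 1\<close> amounts to \<open>p < golden * (1 - p)\<close>: the leader holds less than \<open>golden\<close> times as many cards as the replier.
  The slack \<open>g\<close> in this inequality pays for the deviation \<open>\<delta>\<close> of the proportions in the blocks and
  for the fraction \<open>\<delta>\<close> of each block that is set aside for the leader's top cards.\<close>

lemma typical_reply_wins:
  fixes D :: "nat \<Rightarrow> int set" and q :: "nat \<Rightarrow> real"
  assumes spread: "\<forall>\<^sub>F m in sequentially. spread_deal (D m) (q m) (M m)"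
    and q: "q \<longlonglongrightarrow> p"
    and size: "filterlim (\<lambda>m. card (D m)) at_top sequentially"
    and p: "0 \<le> p" "golden * p < 1"
  shows "(\<lambda>m. measure_pmf.prob (M m) {A. reply_wins A (D m - A)}) \<longlonglongrightarrow> 1"
proof -
  define g where "g = golden * (1 - p) - p"
  have "golden * (golden * p) < golden * 1"
    using p golden_gt_1 by (intro mult_strict_left_mono) auto
  then have g: "g > 0" unfolding golden_mult_golden by (simp add: g_def algebra_simps)
  define \<delta> where "\<delta> = g / 2 / (1 + 2 * golden)"
  have \<delta>: "\<delta> > 0" using g golden_gt_1 by (simp add: \<delta>_def)
  have "1 + 2 * golden \<noteq> 0" using golden_gt_1 by simp
  then have "\<delta> * (1 + 2 * golden) = g / 2"
    by (rule nonzero_eq_divide_eq[THEN iffD1, OF _ \<delta>_def])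
  then have \<delta>_eq: "\<delta> + 2 * (golden * \<delta>) = g / 2" by (simp add: algebra_simps)
  \<comment> \<open>For large \<open>m\<close>, the top block and the remainder of the division hold at most \<open>2 * s m\<close> cards; the \<open>k\<close> blocks
    above the lowest one set aside \<open>k * \<delta> * s m\<close>.\<close>
  obtain k :: nat where "2 * golden / \<delta> < k" using reals_Archimedean2 by blast
  then have k: "2 * golden < k * \<delta>" using \<delta> by (simp add: field_simps)
  define s where "s m = card (D m) div Suc k" for m
  have s: "filterlim s at_top sequentially"
    unfolding filterlim_at_top
  proof
    fix Z
    have "\<forall>\<^sub>F m in sequentially. Z * Suc k \<le> card (D m)"
      using size by (simp add: filterlim_at_top)
    then show "\<forall>\<^sub>F m in sequentially. Z \<le> s m"
      by eventually_elim (simp add: s_def less_eq_div_iff_mult_less_eq del: mult_Suc_right)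
  qed
  \<comment> \<open>Large enough to absorb the rounding in the definition of \<open>y\<close> below.\<close>
  obtain S0 :: nat where S0: "2 * golden / g < S0" using reals_Archimedean2 by blast
  have ev_s: "\<forall>\<^sub>F m in sequentially. S0 + Suc k \<le> s m" using s by (simp add: filterlim_at_top)
  have ev_q: "\<forall>\<^sub>F m in sequentially. dist (q m) p < \<delta> / 2"
    using q \<delta> by (intro tendstoD) auto
  define C where "C = real (Suc k) * (4 / \<delta>\<^sup>2)"
  show ?thesis
  proof (rule tendsto_1_if_failure_small[OF s])
    show "\<forall>\<^sub>F m in sequentially. 1 - C / real (s m)
        \<le> measure_pmf.prob (M m) {A. reply_wins A (D m - A)}"
      using spread ev_s ev_q
    proof eventually_elim
      case (elim m)
      have finD: "finite (D m)" and sub: "\<And>A. A \<in> set_pmf (M m) \<Longrightarrow> A \<subseteq> D m"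
        using elim(1) by (auto simp: spread_deal_def)
      have spos: "real (s m) > 0" using elim(2) by simp
      have "2 * golden / g < real (s m)" using S0 elim(2) by linarith
      then have s_large: "golden < g / 2 * s m" using g by (simp add: field_simps)
      have le: "Suc k * s m \<le> card (D m)" by (simp add: s_def del: mult_Suc)
      obtain I where I: "\<And>i. i < Suc k \<Longrightarrow> I i \<subseteq> D m" "\<And>i. i < Suc k \<Longrightarrow> card (I i) = s m"
        "\<And>i j x y. i < j \<Longrightarrow> j < Suc k \<Longrightarrow> x \<in> I i \<Longrightarrow> y \<in> I j \<Longrightarrow> x < y"
        using consecutive_blocks[OF finD le] by blast
      define bad where "bad = (\<Union>i<Suc k. {A. \<delta> / 2 * s m \<le> \<bar>real (card (A \<inter> I i)) - q m * card (I i)\<bar>})"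
      have "measure_pmf.prob (M m) bad \<le>
          (\<Sum>i<Suc k. measure_pmf.prob (M m) {A. \<delta> / 2 * s m \<le> \<bar>real (card (A \<inter> I i)) - q m * card (I i)\<bar>})"
        unfolding bad_def by (intro measure_pmf.finite_measure_subadditive_finite) auto
      also have "\<dots> \<le> (\<Sum>i<Suc k. s m / (\<delta> / 2 * s m)\<^sup>2)"
      proof (rule sum_mono)
        fix i assume "i \<in> {..<Suc k}"
        then have "i < Suc k" by simp
        then show "measure_pmf.prob (M m) {A. \<delta> / 2 * s m \<le> \<bar>real (card (A \<inter> I i)) - q m * card (I i)\<bar>}
            \<le> s m / (\<delta> / 2 * s m)\<^sup>2"
          using spread_deal_deviation[OF elim(1) I(1)[of i], of "\<delta> / 2 * s m"] \<delta> spos I(2)[of i]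
          by simp
      qed
      also have "\<dots> = C / s m"
        using \<delta> spos by (simp add: C_def power2_eq_square field_simps)
      finally have bad: "measure_pmf.prob (M m) bad \<le> C / s m" .
      define y where "y = nat \<lfloor>(1 - p - 2 * \<delta>) * s m\<rfloor>"
      have "golden * (1 - p - 2 * \<delta>) = p + g - 2 * (golden * \<delta>)"
        by (simp add: g_def algebra_simps)
      also have "\<dots> > 0" using p g \<delta> \<delta>_eq by linarith
      finally have "1 - p - 2 * \<delta> > 0" using golden_gt_1 by (simp add: zero_less_mult_iff)
      then have y: "real y \<le> (1 - p - 2 * \<delta>) * s m" "(1 - p - 2 * \<delta>) * s m - 1 \<le> real y"
        using spos unfolding y_def by (auto intro: of_nat_floor)
      have "golden * ((1 - p - 2 * \<delta>) * s m - 1) \<le> golden * y"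
        using y(2) golden_gt_1 by (intro mult_left_mono) auto
      moreover have "golden * ((1 - p - 2 * \<delta>) * s m - 1) - (p + \<delta>) * s m
          = (g - (\<delta> + 2 * (golden * \<delta>))) * s m - golden"
        by (simp add: g_def algebra_simps)
      then have "golden * ((1 - p - 2 * \<delta>) * s m - 1) - (p + \<delta>) * s m = g / 2 * s m - golden"
        unfolding \<delta>_eq by simp
      ultimately have a: "(p + \<delta>) * s m < golden * y" using s_large by linarith
      have sum: "(p + \<delta>) * s m + y + \<delta> * s m \<le> s m"
        using y(1) by (simp add: algebra_simps)
      have "card (D m) < Suc k * s m + Suc k"
        unfolding s_def by (metis add.commute dividend_less_times_div mult.commute zero_less_Suc)
      then have "real (card (D m)) \<le> k * s m + 2 * s m"
        using elim(2) of_nat_less_iff[of "card (D m)" "Suc k * s m + Suc k", where 'a = real]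
        by (simp add: algebra_simps)
      then have "golden * (real (card (D m)) - k * s m) \<le> golden * (2 * s m)"
        using golden_gt_1 by (intro mult_left_mono) auto
      also have "\<dots> < k * \<delta> * s m" using k spos by simp
      finally have top: "golden * (real (card (D m)) - k * s m) < k * (\<delta> * s m)" by (simp add: mult_ac)
      show ?case
      proof (rule prob_good_ge[OF _ bad], intro ballI impI)
        fix A assume A: "A \<in> set_pmf (M m)" "A \<notin> bad"
        have few: "card (A \<inter> I i) \<le> (p + \<delta>) * s m" if i: "i < Suc k" for i
        proof -
          have "\<bar>real (card (A \<inter> I i)) - q m * s m\<bar> < \<delta> / 2 * s m"
          proof -
            have "\<not> \<delta> / 2 * s m \<le> \<bar>real (card (A \<inter> I i)) - q m * card (I i)\<bar>"
              using A(2) i unfolding bad_def by blast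
            then show ?thesis using I(2)[OF i] by (simp add: not_le)
          qed
          then have "card (A \<inter> I i) < q m * s m + \<delta> / 2 * s m" by linarith
          moreover have "\<bar>q m - p\<bar> < \<delta> / 2" using elim(3) by (simp add: dist_real_def)
          then have "q m * s m \<le> (p + \<delta> / 2) * s m"
            by (intro mult_right_mono) (linarith, simp)
          ultimately show ?thesis by (simp add: algebra_simps)
        qed
        have "reply_wins A (D m - A)"
          by (rule reply_wins_by_blocks[OF finD sub[OF A(1)] I few a sum _ top]) (use \<delta> in auto)
        then show "A \<in> {A. reply_wins A (D m - A)}" by simp
      qed
    qed
  qed simp
qed

text \<open>The condition \<open>golden * p > 1\<close> amounts to \<open>p > golden * (1 - p)\<close>, so the law of large numbers
  applies.\<close>

lemma typical_deal_many:
  fixes D :: "nat \<Rightarrow> int set" and q :: "nat \<Rightarrow> real"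
  assumes spread: "\<forall>\<^sub>F m in sequentially. spread_deal (D m) (q m) (M m)"
    and q: "q \<longlonglongrightarrow> p"
    and size: "filterlim (\<lambda>m. card (D m)) at_top sequentially"
    and p: "golden * p > 1"
  shows "(\<lambda>m. measure_pmf.prob (M m) {A. golden * card (D m - A) < card A}) \<longlonglongrightarrow> 1"
proof -
  define g where "g = p - golden * (1 - p)"
  have "golden * 1 < golden * (golden * p)"
    using p golden_gt_1 by (intro mult_strict_left_mono) auto
  then have g: "g > 0" unfolding golden_mult_golden by (simp add: g_def algebra_simps)
  define \<delta> where "\<delta> = g / 2 / (1 + golden)"
  have \<delta>: "\<delta> > 0" using g golden_gt_1 by (simp add: \<delta>_def)
  have "1 + golden \<noteq> 0" using golden_gt_1 by simp
  then have "\<delta> * (1 + golden) = g / 2"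
    by (rule nonzero_eq_divide_eq[THEN iffD1, OF _ \<delta>_def])
  then have \<delta>_eq: "\<delta> + golden * \<delta> = g / 2" by (simp add: algebra_simps)
  have ev_n: "\<forall>\<^sub>F m in sequentially. 1 \<le> card (D m)" using size by (simp add: filterlim_at_top)
  have ev_q: "\<forall>\<^sub>F m in sequentially. dist (q m) p < \<delta> / 2"
    using q \<delta> by (intro tendstoD) auto
  show ?thesis
  proof (rule tendsto_1_if_failure_small[OF size])
    show "\<forall>\<^sub>F m in sequentially. 1 - (4 / \<delta>\<^sup>2) / real (card (D m))
        \<le> measure_pmf.prob (M m) {A. golden * card (D m - A) < card A}"
      using spread ev_n ev_q
    proof eventually_elim
      case (elim m)
      let ?n = "card (D m)"
      have finD: "finite (D m)" and sub: "\<And>A. A \<in> set_pmf (M m) \<Longrightarrow> A \<subseteq> D m"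
        using elim(1) by (auto simp: spread_deal_def)
      have n: "real ?n > 0" using elim(2) by simp
      define bad where "bad = {A. \<delta> / 2 * ?n \<le> \<bar>real (card (A \<inter> D m)) - q m * ?n\<bar>}"
      have "measure_pmf.prob (M m) bad \<le> ?n / (\<delta> / 2 * ?n)\<^sup>2"
        using spread_deal_deviation[OF elim(1) order_refl, of "\<delta> / 2 * ?n"] \<delta> n
        by (simp add: bad_def)
      also have "\<dots> = (4 / \<delta>\<^sup>2) / ?n"
        using \<delta> n by (simp add: power2_eq_square field_simps)
      finally have bad: "measure_pmf.prob (M m) bad \<le> (4 / \<delta>\<^sup>2) / ?n" .
      show ?case
      proof (rule prob_good_ge[OF _ bad], intro ballI impI)
        fix A assume A: "A \<in> set_pmf (M m)" "A \<notin> bad"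
        have AD: "A \<inter> D m = A" using sub[OF A(1)] by blast
        have "\<bar>real (card A) - q m * ?n\<bar> < \<delta> / 2 * ?n"
          using A(2) AD by (simp add: bad_def not_le)
        then have "q m * ?n - \<delta> / 2 * ?n < card A" by linarith
        moreover have "\<bar>q m - p\<bar> < \<delta> / 2" using elim(3) by (simp add: dist_real_def)
        then have "(p - \<delta> / 2) * ?n \<le> q m * ?n"
          by (intro mult_right_mono) (linarith, simp)
        ultimately have many: "(p - \<delta>) * ?n < card A" by (simp add: algebra_simps)
        have "real (card (D m - A)) = real ?n - real (card A)"
          using finD sub[OF A(1)] by (simp add: card_Diff_subset finite_subset card_mono of_nat_diff)
        then have "golden * card (D m - A) \<le> golden * (?n - (p - \<delta>) * ?n)"
          using many golden_gt_1 by (intro mult_left_mono) auto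
        also have "\<dots> = (p - \<delta>) * ?n - (g - (\<delta> + golden * \<delta>)) * ?n"
          by (simp add: g_def algebra_simps)
        also have "\<dots> \<le> (p - \<delta>) * ?n"
          unfolding \<delta>_eq using g n by simp
        also note many
        finally show "A \<in> {A. golden * card (D m - A) < card A}" by simp
      qed
    qed
  qed simp
qed

section \<open>Limits of the winning probabilities\<close>

text \<open>Alice cannot force a win if Bob wins as the replier, and vice versa; the second event is the first
  one for the complementary deal.\<close>

lemma prob_neither_tendsto_1:
  fixes D :: "nat \<Rightarrow> int set" and q :: "nat \<Rightarrow> real"
  assumes spread: "\<forall>\<^sub>F m in sequentially. spread_deal (D m) (q m) (M m)"
    and q: "q \<longlonglongrightarrow> p"
    and size: "filterlim (\<lambda>m. card (D m)) at_top sequentially"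
    and p: "0 \<le> p" "p \<le> 1" "golden * p < 1" "golden * (1 - p) < 1"
  shows "(\<lambda>m. prob_neither_has_ws (D m) (M m)) \<longlonglongrightarrow> 1"
proof -
  define M' where "M' m = map_pmf (\<lambda>A. D m - A) (M m)" for m
  let ?a = "\<lambda>m. measure_pmf.prob (M m) {A. reply_wins A (D m - A)}"
  let ?b = "\<lambda>m. measure_pmf.prob (M' m) {A. reply_wins A (D m - A)}"
  have a: "?a \<longlonglongrightarrow> 1" by (rule typical_reply_wins[OF spread q size p(1,3)])
  have spread': "\<forall>\<^sub>F m in sequentially. spread_deal (D m) (1 - q m) (M' m)"
    using spread by eventually_elim (simp add: M'_def spread_deal_complement)
  have "?b \<longlonglongrightarrow> 1"
    by (rule typical_reply_wins[OF spread' tendsto_diff[OF tendsto_const q] size]) (use p in auto)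
  with a have "(\<lambda>m. ?a m + ?b m - 1) \<longlonglongrightarrow> 1 + 1 - 1" by (intro tendsto_intros)
  then have lower: "(\<lambda>m. ?a m + ?b m - 1) \<longlonglongrightarrow> 1" by simp
  have nonempty: "\<forall>\<^sub>F m in sequentially. 1 \<le> card (D m)" using size by (simp add: filterlim_at_top)
  show ?thesis
  proof (rule tendsto_sandwich[OF _ _ lower tendsto_const])
    show "\<forall>\<^sub>F m in sequentially. ?a m + ?b m - 1 \<le> prob_neither_has_ws (D m) (M m)"
      using spread nonempty
    proof eventually_elim
      case (elim m)
      let ?bad = "{A. \<not> reply_wins A (D m - A)} \<union> {A. \<not> reply_wins (D m - A) (D m - (D m - A))}"
      have "?a m = 1 - measure_pmf.prob (M m) {A. \<not> reply_wins A (D m - A)}"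
        using measure_pmf.prob_compl[of "{A. \<not> reply_wins A (D m - A)}" "M m"]
        by (simp add: Compl_eq_Diff_UNIV[symmetric] Collect_neg_eq[symmetric])
      moreover have "?b m = 1 - measure_pmf.prob (M m) {A. \<not> reply_wins (D m - A) (D m - (D m - A))}"
        using measure_pmf.prob_compl[of "{A. \<not> reply_wins (D m - A) (D m - (D m - A))}" "M m"]
        by (simp add: M'_def vimage_def Compl_eq_Diff_UNIV[symmetric] Collect_neg_eq[symmetric])
      moreover have "measure_pmf.prob (M m) ?bad \<le> measure_pmf.prob (M m) {A. \<not> reply_wins A (D m - A)}
          + measure_pmf.prob (M m) {A. \<not> reply_wins (D m - A) (D m - (D m - A))}"
        by (intro measure_Un_le) auto
      moreover have "1 - measure_pmf.prob (M m) ?bad \<le> prob_neither_has_ws (D m) (M m)"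
        unfolding prob_neither_has_ws_def
      proof (rule prob_good_ge[OF _ order_refl], intro ballI impI)
        fix A assume A: "A \<in> set_pmf (M m)" "A \<notin> ?bad"
        then have sub: "A \<subseteq> D m" "finite (D m)" using elim(1) by (auto simp: spread_deal_def)
        then have "valid_position (A, D m - A)"
          using elim(2) finite_subset by (auto simp: valid_position_def)
        moreover have "D m - (D m - A) = A" using sub by blast
        ultimately show "A \<in> {A. \<not> alice_has_winning_strategy (A, D m - A) \<and>
            \<not> bob_has_winning_strategy (A, D m - A)}"
          using A(2) reply_wins_no_alice_strategy reply_wins_no_bob_strategy by auto
      qed
      ultimately show ?case by linarith
    qed
    show "\<forall>\<^sub>F m in sequentially. prob_neither_has_ws (D m) (M m) \<le> 1"
      by (simp add: prob_neither_has_ws_def)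
  qed
qed

lemma prob_alice_tendsto_1:
  fixes D :: "nat \<Rightarrow> int set" and q :: "nat \<Rightarrow> real"
  assumes spread: "\<forall>\<^sub>F m in sequentially. spread_deal (D m) (q m) (M m)"
    and q: "q \<longlonglongrightarrow> p"
    and size: "filterlim (\<lambda>m. card (D m)) at_top sequentially"
    and p: "golden * p > 1"
  shows "(\<lambda>m. prob_alice_has_ws (D m) (M m)) \<longlonglongrightarrow> 1"
proof (rule tendsto_sandwich[OF _ _ typical_deal_many[OF assms] tendsto_const])
  show "\<forall>\<^sub>F m in sequentially. measure_pmf.prob (M m) {A. golden * card (D m - A) < card A}
      \<le> prob_alice_has_ws (D m) (M m)"
    using spread
  proof eventually_elim
    case (elim m)
    show ?case
      unfolding prob_alice_has_ws_def
    proof (rule measure_pmf.finite_measure_mono_AE)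
      have "alice_has_winning_strategy (A, D m - A)"
        if A: "A \<in> set_pmf (M m)" and many: "golden * card (D m - A) < card A" for A
      proof (rule not_reply_wins_alice_strategy)
        have sub: "A \<subseteq> D m" "finite (D m)" using elim A by (auto simp: spread_deal_def)
        then have fin: "finite A" "finite (D m - A)" by (auto intro: finite_subset)
        have "0 \<le> golden * card (D m - A)" using golden_gt_1 by simp
        then have "A \<noteq> {}" using many by auto
        then show "valid_position (A, D m - A)" using fin by (auto simp: valid_position_def)
        show "\<not> reply_wins (fst (A, D m - A)) (snd (A, D m - A))"
          using not_reply_wins_if_many[OF fin _ many] by simp
      qed
      then show "AE A in M m. A \<in> {A. golden * card (D m - A) < card A} \<longrightarrow>
          A \<in> {A. alice_has_winning_strategy (A, D m - A)}"
        by (simp add: AE_measure_pmf_iff)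
    qed simp
  qed
  show "\<forall>\<^sub>F m in sequentially. prob_alice_has_ws (D m) (M m) \<le> 1"
    by (simp add: prob_alice_has_ws_def)
qed

lemma rounded_fraction:
  fixes k :: "nat \<Rightarrow> nat" and x :: real
  assumes k: "\<And>n. int (k n) = \<lfloor>x * real n\<rfloor> \<or> int (k n) = \<lceil>x * real n\<rceil>" and x: "x \<le> 1"
  shows "k n \<le> n" and "(\<lambda>n. k n / n) \<longlonglongrightarrow> x"
proof -
  have "x * real n \<le> real_of_int (int n)" using x mult_right_mono[of x 1 "real n"] by simp
  then have "\<lceil>x * real n\<rceil> \<le> int n" by (simp only: ceiling_le_iff)
  moreover have "\<lfloor>x * real n\<rfloor> \<le> \<lceil>x * real n\<rceil>" by (rule floor_le_ceiling)
  ultimately show "k n \<le> n" using k[of n] by linarith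
  have close: "\<bar>real (k n) - x * n\<bar> \<le> 1" for n
  proof -
    have "real (k n) = real_of_int (int (k n))" by simp
    then show ?thesis using k[of n] by linarith
  qed
  have "(\<lambda>n. k n / n - x) \<longlonglongrightarrow> 0"
  proof (rule Lim_null_comparison)
    show "\<forall>\<^sub>F n in sequentially. norm (k n / n - x) \<le> 1 / real n"
      using eventually_gt_at_top[of 0]
    proof eventually_elim
      case (elim n)
      then have "k n / n - x = (real (k n) - x * n) / n" by (simp add: field_simps)
      then show ?case using close[of n] by (simp add: divide_right_mono)
    qed
    show "(\<lambda>n. 1 / real n) \<longlonglongrightarrow> 0" by (rule lim_1_over_n)
  qed
  then show "(\<lambda>n. k n / n) \<longlonglongrightarrow> x" by (simp add: LIM_zero_iff)
qed

lemma golden_fraction: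
  assumes "r \<ge> 1"
  shows "golden * (r / (r + 1)) < 1 \<longleftrightarrow> r < golden" and "golden * (r / (r + 1)) > 1 \<longleftrightarrow> r > golden"
    and "golden * (1 - r / (r + 1)) < 1"
proof -
  have inv: "golden * (golden - 1) = 1" using golden_mult_golden[of 1] by (simp add: algebra_simps)
  have "golden * (r / (r + 1)) < 1 \<longleftrightarrow> (golden - 1) * r < 1"
    using assms by (simp add: field_simps)
  also have "\<dots> \<longleftrightarrow> golden * ((golden - 1) * r) < golden * 1"
    using golden_gt_1 by simp
  also have "golden * ((golden - 1) * r) = r" using inv by (simp flip: mult.assoc)
  finally show "golden * (r / (r + 1)) < 1 \<longleftrightarrow> r < golden" by simp
  have "golden * (r / (r + 1)) > 1 \<longleftrightarrow> (golden - 1) * r > 1"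
    using assms by (simp add: field_simps)
  also have "\<dots> \<longleftrightarrow> golden * 1 < golden * ((golden - 1) * r)"
    using golden_gt_1 by simp
  also have "golden * ((golden - 1) * r) = r" using inv by (simp flip: mult.assoc)
  finally show "golden * (r / (r + 1)) > 1 \<longleftrightarrow> r > golden" by simp
  have "sqrt 5 < sqrt (3\<^sup>2)" by (rule real_sqrt_less_mono) simp
  then have "golden < 2" by (simp add: golden_def)
  then show "golden * (1 - r / (r + 1)) < 1" using assms by (simp add: field_simps)
qed

theorem mainTheorem1:
  fixes D :: "nat \<Rightarrow> int set" and \<phi> :: real
  assumes deck: "\<And>n. finite (D n) \<and> card (D n) = n"
    and phi: "\<phi> = (1 + sqrt 5) / 2"
  shows
    "((\<lambda>m. prob_neither_has_ws (D (2 * m)) (deal_fixed_size (D (2 * m)) m)) \<longlonglongrightarrow> 1) \<and>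
     ((\<lambda>n. prob_neither_has_ws (D n) (deal_independent (D n) (1 / 2))) \<longlonglongrightarrow> 1) \<and>
     (\<forall>r::real. r \<ge> 1 \<longrightarrow>
       (r < \<phi> \<longrightarrow>
         (\<forall>k :: nat \<Rightarrow> nat.
            (\<forall>n. int (k n) = \<lfloor>r / (r + 1) * real n\<rfloor> \<or> int (k n) = \<lceil>r / (r + 1) * real n\<rceil>) \<longrightarrow>
            (\<lambda>n. prob_neither_has_ws (D n) (deal_fixed_size (D n) (k n))) \<longlonglongrightarrow> 1) \<and>
         (\<lambda>n. prob_neither_has_ws (D n) (deal_independent (D n) (r / (r + 1)))) \<longlonglongrightarrow> 1) \<and>
       (r > \<phi> \<longrightarrow>
         (\<forall>k :: nat \<Rightarrow> nat.
            (\<forall>n. int (k n) = \<lfloor>r / (r + 1) * real n\<rfloor> \<or> int (k n) = \<lceil>r / (r + 1) * real n\<rceil>) \<longrightarrow>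
            (\<lambda>n. prob_alice_has_ws (D n) (deal_fixed_size (D n) (k n))) \<longlonglongrightarrow> 1) \<and>
         (\<lambda>n. prob_alice_has_ws (D n) (deal_independent (D n) (r / (r + 1)))) \<longlonglongrightarrow> 1))"
proof -
  have \<phi>: "\<phi> = golden" using phi by (simp add: golden_def)
  have fin: "finite (D n)" and card: "card (D n) = n" for n using deck by auto
  have size: "filterlim (\<lambda>n. card (D n)) at_top sequentially"
    unfolding card by (rule filterlim_ident)
  have indep: "\<forall>\<^sub>F n in sequentially. spread_deal (D n) p (deal_independent (D n) p)"
    if "0 \<le> p" "p \<le> 1" for p
    using that fin by (simp add: spread_deal_independent)
  have fixed: "\<forall>\<^sub>F n in sequentially. spread_deal (D n) (k n / n) (deal_fixed_size (D n) (k n))"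
    if "\<And>n. k n \<le> n" for k :: "nat \<Rightarrow> nat"
    using spread_deal_fixed_size[OF fin] that card by simp
  have half: "golden * (1 / 2) < 1" using golden_fraction(3)[of 1] by simp
  have even_spread: "\<forall>\<^sub>F m in sequentially. spread_deal (D (2 * m)) (m / (2 * m)) (deal_fixed_size (D (2 * m)) m)"
    using spread_deal_fixed_size[OF fin] card by (intro always_eventually allI) (metis le_add1 mult_2 of_nat_mult of_nat_numeral)
  have even_size: "filterlim (\<lambda>m. card (D (2 * m))) at_top sequentially"
    unfolding card by (rule mult_nat_left_at_top) simp
  have even_half: "(\<lambda>m. real m / (2 * m)) \<longlonglongrightarrow> 1 / 2"
    by (rule tendsto_eventually) (use eventually_gt_at_top[of 0] in \<open>eventually_elim, simp\<close>)
  have "(\<lambda>m. prob_neither_has_ws (D (2 * m)) (deal_fixed_size (D (2 * m)) m)) \<longlonglongrightarrow> 1"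
    by (rule prob_neither_tendsto_1[OF even_spread even_half even_size]) (use half in auto)
  moreover have "(\<lambda>n. prob_neither_has_ws (D n) (deal_independent (D n) (1 / 2))) \<longlonglongrightarrow> 1"
    by (rule prob_neither_tendsto_1[OF indep tendsto_const size]) (use half in auto)
  moreover have
    "(r < \<phi> \<longrightarrow>
         (\<forall>k :: nat \<Rightarrow> nat.
            (\<forall>n. int (k n) = \<lfloor>r / (r + 1) * real n\<rfloor> \<or> int (k n) = \<lceil>r / (r + 1) * real n\<rceil>) \<longrightarrow>
            (\<lambda>n. prob_neither_has_ws (D n) (deal_fixed_size (D n) (k n))) \<longlonglongrightarrow> 1) \<and>
         (\<lambda>n. prob_neither_has_ws (D n) (deal_independent (D n) (r / (r + 1)))) \<longlonglongrightarrow> 1) \<and>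
     (r > \<phi> \<longrightarrow>
         (\<forall>k :: nat \<Rightarrow> nat.
            (\<forall>n. int (k n) = \<lfloor>r / (r + 1) * real n\<rfloor> \<or> int (k n) = \<lceil>r / (r + 1) * real n\<rceil>) \<longrightarrow>
            (\<lambda>n. prob_alice_has_ws (D n) (deal_fixed_size (D n) (k n))) \<longlonglongrightarrow> 1) \<and>
         (\<lambda>n. prob_alice_has_ws (D n) (deal_independent (D n) (r / (r + 1)))) \<longlonglongrightarrow> 1)"
    if r: "r \<ge> 1" for r :: real
  proof -
    have p: "0 \<le> r / (r + 1)" "r / (r + 1) \<le> 1" using r by auto
    note frac = golden_fraction[OF r]
    show ?thesis
    proof (intro conjI impI allI)
      fix k :: "nat \<Rightarrow> nat"
      assume "r < \<phi>"
        and k: "\<forall>n. int (k n) = \<lfloor>r / (r + 1) * real n\<rfloor> \<or> int (k n) = \<lceil>r / (r + 1) * real n\<rceil>"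
      note k' = rounded_fraction[of k, OF k[rule_format] p(2)]
      show "(\<lambda>n. prob_neither_has_ws (D n) (deal_fixed_size (D n) (k n))) \<longlonglongrightarrow> 1"
        by (rule prob_neither_tendsto_1[OF fixed[OF k'(1)] k'(2) size p])
          (use frac \<phi> \<open>r < \<phi>\<close> in auto)
    next
      assume "r < \<phi>"
      then show "(\<lambda>n. prob_neither_has_ws (D n) (deal_independent (D n) (r / (r + 1)))) \<longlonglongrightarrow> 1"
        using frac \<phi> by (intro prob_neither_tendsto_1[OF indep[OF p] tendsto_const size p]) auto
    next
      fix k :: "nat \<Rightarrow> nat"
      assume "r > \<phi>"
        and k: "\<forall>n. int (k n) = \<lfloor>r / (r + 1) * real n\<rfloor> \<or> int (k n) = \<lceil>r / (r + 1) * real n\<rceil>"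
      note k' = rounded_fraction[of k, OF k[rule_format] p(2)]
      show "(\<lambda>n. prob_alice_has_ws (D n) (deal_fixed_size (D n) (k n))) \<longlonglongrightarrow> 1"
        by (rule prob_alice_tendsto_1[OF fixed[OF k'(1)] k'(2) size])
          (use frac \<phi> \<open>r > \<phi>\<close> in auto)
    next
      assume "r > \<phi>"
      then show "(\<lambda>n. prob_alice_has_ws (D n) (deal_independent (D n) (r / (r + 1)))) \<longlonglongrightarrow> 1"
        using frac \<phi> by (intro prob_alice_tendsto_1[OF indep[OF p] tendsto_const size]) auto
    qed
  qed
  ultimately show ?thesis by blast
qed

end
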